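(* Let $\mathbb{F}$ be an algebraically closed field of characteristic $p>2$, let $L$ be a restricted Lie superalgebra over $\mathbb{F}$ and let $K$ be a strongly abelian restricted Lie superalgebra. Then the set of equivalence classes of restricted central extensions of $L$ by $K$ is in one-to-one correspondence with $H^2_*(L;K)$, where $K$ is regarded as a trivial $L$-module. In particular, $H^2_*(L;\mathbb{F})$ is in one-to-one correspondence with the equivalence classes of $1$-dimensional restricted central extensions of $L$.
   Context: $|x|\in\mathbb{Z}_2$ denotes the parity of a homogeneous element $x$; formulas involving parities are stated for homogeneous elements and extended linearly. A Lie superalgebra is a superspace $L=L_{\bar0}\oplus L_{\bar1}$ with an even bilinear bracket satisfying $[x,y]=-(-1)^{|x||y|}[y,x]$ and $[x,[y,z]]=[[x,y],z]+(-1)^{|x||y|}[y,[x,z]]$. A restricted Lie superalgebra is a Lie superalgebra $L$ with a map $[p]:L_{\bar0}\to L_{\bar0}$, $x\mapsto x^{[p]}$, such that $(L_{\bar0},[p])$ is a restricted Lie algebra and $L_{\bar1}$ is a restricted $L_{\bar0}$-module. A restricted Lie superalgebra $K$ is strongly abelian if $[K,K]=0$ and $K_{\bar0}^{[p]}=0$. A restricted extension of $L$ by $K$ is an exact sequence $0\to K\xrightarrow{\iota}E\xrightarrow{\pi}L\to0$ of restricted Lie superalgebras and homomorphisms; it is central if $\iota(K)$ is contained in the center of $E$. Two extensions $E_1,E_2$ (with maps $\iota_i,\pi_i$) are equivalent if there is an isomorphism of restricted Lie superalgebras $\sigma:E_1\to E_2$ with $\sigma\iota_1=\iota_2$ and $\pi_2\sigma=\pi_1$.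 For a central extension the induced $L$-module structure on $K$ is trivial. Restricted cohomology in degree $2$ with coefficients in a trivial $L$-module $M$ (the action being zero, all terms involving it are omitted). Let $\bigwedge^2L$ be $L\otimes L$ modulo the span of the elements $x\otimes y+(-1)^{|x||y|}y\otimes x$, and define $\bigwedge^3 L$ analogously; let $C^q(L;M)=\mathrm{Hom}_{\mathbb F}(\bigwedge^qL,M)$. For $\varphi\in C^1(L;M)=\mathrm{Hom}_{\mathbb F}(L,M)$ let $d^1\varphi(x,y)=-\varphi([x,y])$, and for $\alpha\in C^2(L;M)$ let $$d^2\alpha(x_1,x_2,x_3)=-\alpha([x_1,x_2],x_3)+(-1)^{|x_2||x_3|}\alpha([x_1,x_3],x_2)-(-1)^{|x_1|(|x_2|+|x_3|)}\alpha([x_2,x_3],x_1).$$ Write $[x_1,\ldots,x_r]=[[\cdots[[x_1,x_2],x_3],\cdots],x_r]$. A map $\omega:L_{\bar0}\to M$ has the $*$-property with respect to $\varphi\in C^2(L;M)$ if for all $\lambda\in\mathbb F$, $x,y\in L_{\bar0}$: (i) $\omega(\lambda x)=\lambda^p\omega(x)$; (ii) $$\omega(x+y)=\omega(x)+\omega(y)+\sum_{\substack{x_i=x\text{ or }y\\ x_1=x,\ x_2=y}}\frac{1}{\sharp(x)}\varphi([x_1,\ldots,x_{p-1}],x_p),$$ the sum being over sequences $(x_1,\ldots,x_p)$ and $\sharp(x)$ the number of factors $x_i$ equal to $x$. Let $C^1_*(L;M)=C^1(L;M)$ and $$C^2_*(L;M)=\{(\varphi,\omega)\mid\varphi\in C^2(L;M),\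 \omega:L_{\bar0}\to M\text{ has the }*\text{-property w.r.t. }\varphi\}.$$ For $\varphi\in C^1_*(L;M)$ set $\mathrm{ind}^1(\varphi)(x)=\varphi(x^{[p]})$ and $d^1_*(\varphi)=(d^1\varphi,\mathrm{ind}^1(\varphi))\in C^2_*(L;M)$. For $(\alpha,\beta)\in C^2_*(L;M)$ and $x,y\in L_{\bar0}$ set $$\mathrm{ind}^2(\alpha,\beta)(x,y)=\alpha(x,y^{[p]})-\alpha([x,\underbrace{y,\ldots,y}_{p-1}],y),\qquad d^2_*(\alpha,\beta)=(d^2\alpha,\mathrm{ind}^2(\alpha,\beta)).$$ Then $Z^2_*(L;M)=\mathrm{Ker}\,d^2_*=\{(\alpha,\beta): d^2\alpha=0,\ \mathrm{ind}^2(\alpha,\beta)=0\}$, $B^2_*(L;M)=\mathrm{Im}\,d^1_*$, and $H^2_*(L;M)=Z^2_*(L;M)/B^2_*(L;M)$.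
   Formalization: Definitions corrected, as the claim fails as printed: cochains preserve parity and ω maps L_0 into K_0; ind²(α,β)(x,y) must vanish for all x in L (y in L_0), not only x in L_0; d¹_*φ is (d¹φ, −ind¹φ), since (d¹φ, ind¹φ) lacks the *-property. *)

theory Defs
  imports "HOL-Computational_Algebra.Computational_Algebra" "HOL-Library.Z2"
    "HOL-Library.Product_Plus" "HOL-Library.Function_Algebras"
begin

section \<open>Restricted Lie superalgebras\<close>

text \<open>
  A superalgebra over the field \<open>'f\<close> lives on a whole type \<open>'a\<close>, whose class
  \<^class>\<open>ab_group_add\<close> supplies the addition. Parities are elements of \<^typ>\<open>bit\<close>.
  The \<open>p\<close>-map is a total function, of which only the values on the even part
  are ever used. The characteristic is \<open>CHAR('f)\<close>.
\<close>

record ('f, 'a) superalg =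
  scl :: "'f \<Rightarrow> 'a \<Rightarrow> 'a"
  grade :: "bit \<Rightarrow> 'a set"
  brk :: "'a \<Rightarrow> 'a \<Rightarrow> 'a"
  pmap :: "'a \<Rightarrow> 'a"

text \<open>\<open>koszul i v\<close> is $(-1)^i v$.\<close>

definition koszul :: "bit \<Rightarrow> 'a::ab_group_add \<Rightarrow> 'a"
  where "koszul i v = (if i = 0 then v else - v)"

definition superspace :: "('f::field, 'a::ab_group_add) superalg \<Rightarrow> bool"
  where "superspace A \<longleftrightarrow>
    vector_space (scl A) \<and>
    (\<forall>i. module.subspace (scl A) (grade A i)) \<and>
    grade A 0 \<inter> grade A 1 = {0} \<and>
    (\<forall>x. \<exists>a\<in>grade A 0. \<exists>b\<in>grade A 1. x = a + b)"

definition even_linear ::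
    "('f::field, 'a::ab_group_add) superalg \<Rightarrow> ('f, 'b::ab_group_add) superalg \<Rightarrow> ('a \<Rightarrow> 'b) \<Rightarrow> bool"
  where "even_linear A B f \<longleftrightarrow>
    Vector_Spaces.linear (scl A) (scl B) f \<and> (\<forall>i. \<forall>x\<in>grade A i. f x \<in> grade B i)"

definition even_bilinear ::
    "('f::field, 'a::ab_group_add) superalg \<Rightarrow> ('f, 'b::ab_group_add) superalg \<Rightarrow> ('a \<Rightarrow> 'a \<Rightarrow> 'b) \<Rightarrow> bool"
  where "even_bilinear A B f \<longleftrightarrow>
    (\<forall>x. Vector_Spaces.linear (scl A) (scl B) (\<lambda>y. f x y)) \<and>
    (\<forall>y. Vector_Spaces.linear (scl A) (scl B) (\<lambda>x. f x y)) \<and>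
    (\<forall>i j. \<forall>x\<in>grade A i. \<forall>y\<in>grade A j. f x y \<in> grade B (i + j))"

definition super_skew :: "('f, 'a) superalg \<Rightarrow> ('a \<Rightarrow> 'a \<Rightarrow> 'b::ab_group_add) \<Rightarrow> bool"
  where "super_skew A f \<longleftrightarrow>
    (\<forall>i j. \<forall>x\<in>grade A i. \<forall>y\<in>grade A j. f x y = - koszul (i * j) (f y x))"

definition lie_superalgebra :: "('f::field, 'a::ab_group_add) superalg \<Rightarrow> bool"
  where "lie_superalgebra A \<longleftrightarrow>
    superspace A \<and> even_bilinear A A (brk A) \<and> super_skew A (brk A) \<and>
    (\<forall>i j k. \<forall>x\<in>grade A i. \<forall>y\<in>grade A j. \<forall>z\<in>grade A k.
       brk A x (brk A y z) = brk A (brk A x y) z + koszul (i * j) (brk A y (brk A x z)))"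

text \<open>The left-normed bracket $[x_1,\ldots,x_r]$ of a nonempty list.\<close>

definition lbrk :: "('f, 'a) superalg \<Rightarrow> 'a list \<Rightarrow> 'a"
  where "lbrk A xs = foldl (brk A) (hd xs) (tl xs)"

text \<open>
  The sum of $\frac{1}{\sharp(x)} g(x_1,\ldots,x_p)$ over the sequences with
  $x_i = x$ or $y$, $x_1 = x$, $x_2 = y$. The choice of \<open>x\<close> or \<open>y\<close> at each place is
  formal (it matters when \<open>x = y\<close>), hence the Boolean lists: \<open>True\<close> stands for \<open>x\<close>.
\<close>

definition jsum ::
    "('f::field \<Rightarrow> 'b \<Rightarrow> 'b::ab_group_add) \<Rightarrow> ('a list \<Rightarrow> 'b) \<Rightarrow> 'a \<Rightarrow> 'a \<Rightarrow> 'b"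
  where "jsum s g x y =
    (\<Sum>bs | length bs = CHAR('f) \<and> bs ! 0 = True \<and> bs ! 1 = False.
       s (1 / of_nat (count_list bs True)) (g (map (\<lambda>b. if b then x else y) bs)))"

text \<open>
  With \<open>g = lbrk A\<close>, \<open>jsum\<close> is Jacobson's $\sum_{i=1}^{p-1} s_i(x,y)$: the summands with
  $\sharp(x) = i$ add up to $s_i(x,y)$, where $i\,s_i(x,y)$ is the coefficient of
  $t^{i-1}$ in $(\mathrm{ad}(tx+y))^{p-1}(x)$.
\<close>

definition restricted_lie_superalgebra :: "('f::field, 'a::ab_group_add) superalg \<Rightarrow> bool"
  where "restricted_lie_superalgebra A \<longleftrightarrow>
    lie_superalgebra A \<and>
    (\<forall>x\<in>grade A 0. pmap A x \<in> grade A 0) \<and>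
    (\<forall>c. \<forall>x\<in>grade A 0. pmap A (scl A c x) = scl A (c ^ CHAR('f)) (pmap A x)) \<and>
    (\<forall>x\<in>grade A 0. \<forall>y\<in>grade A 0.
       pmap A (x + y) = pmap A x + pmap A y + jsum (scl A) (lbrk A) x y) \<and>
    (\<forall>x\<in>grade A 0. \<forall>y\<in>grade A 0. brk A (pmap A x) y = (brk A x ^^ CHAR('f)) y) \<and>
    (\<forall>x\<in>grade A 0. \<forall>y\<in>grade A 1. brk A (pmap A x) y = (brk A x ^^ CHAR('f)) y)"

definition strongly_abelian :: "('f, 'a::zero) superalg \<Rightarrow> bool"
  where "strongly_abelian A \<longleftrightarrow> (\<forall>x y. brk A x y = 0) \<and> (\<forall>x\<in>grade A 0. pmap A x = 0)"

definition center :: "('f, 'a::zero) superalg \<Rightarrow> 'a set"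
  where "center A = {z. \<forall>x. brk A z x = 0}"

definition restricted_hom ::
    "('f::field, 'a::ab_group_add) superalg \<Rightarrow> ('f, 'b::ab_group_add) superalg \<Rightarrow> ('a \<Rightarrow> 'b) \<Rightarrow> bool"
  where "restricted_hom A B f \<longleftrightarrow>
    even_linear A B f \<and>
    (\<forall>x y. f (brk A x y) = brk B (f x) (f y)) \<and>
    (\<forall>x\<in>grade A 0. f (pmap A x) = pmap B (f x))"

text \<open>The ground field as a purely even, strongly abelian restricted Lie superalgebra.\<close>

definition field_superalg :: "('f::field, 'f) superalg"
  where "field_superalg =
    \<lparr>scl = (*), grade = (\<lambda>i. if i = 0 then UNIV else {0}), brk = (\<lambda>_ _. 0), pmap = (\<lambda>_. 0)\<rparr>"


section \<open>Restricted central extensions\<close>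

text \<open>An extension $0 \to K \to E \to L \to 0$ is a triple of \<open>E\<close> and its two maps.\<close>

type_synonym ('f, 'k, 'e, 'l) extension = "('f, 'e) superalg \<times> ('k \<Rightarrow> 'e) \<times> ('e \<Rightarrow> 'l)"

fun restricted_central_extension ::
    "('f::field, 'l::ab_group_add) superalg \<Rightarrow> ('f, 'k::ab_group_add) superalg \<Rightarrow>
     ('f, 'k, 'e::ab_group_add, 'l) extension \<Rightarrow> bool"
  where "restricted_central_extension L K (E, \<iota>, \<pi>) \<longleftrightarrow>
    restricted_lie_superalgebra E \<and>
    restricted_hom K E \<iota> \<and> restricted_hom E L \<pi> \<and>
    inj \<iota> \<and> range \<iota> = {e. \<pi> e = 0} \<and> surj \<pi> \<and>
    range \<iota> \<subseteq> center E"

text \<open>The extensions compared may live on different types.\<close>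

fun equivalent_extensions ::
    "('f::field, 'k, 'e::ab_group_add, 'l) extension \<Rightarrow> ('f, 'k, 'd::ab_group_add, 'l) extension \<Rightarrow> bool"
  where "equivalent_extensions (E\<^sub>1, \<iota>\<^sub>1, \<pi>\<^sub>1) (E\<^sub>2, \<iota>\<^sub>2, \<pi>\<^sub>2) \<longleftrightarrow>
    (\<exists>\<sigma>. restricted_hom E\<^sub>1 E\<^sub>2 \<sigma> \<and> bij \<sigma> \<and> \<sigma> \<circ> \<iota>\<^sub>1 = \<iota>\<^sub>2 \<and> \<pi>\<^sub>2 \<circ> \<sigma> = \<pi>\<^sub>1)"

text \<open>
  The classes of extensions whose middle term lives on the type \<open>'e\<close>, with the addition
  of \<open>'e\<close>. For \<open>'e = 'l \<times> 'k\<close> every extension of \<open>L\<close> by \<open>K\<close>, on whatever type, is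
  equivalent to one of these.
\<close>

definition extension_classes ::
    "('f::field, 'l::ab_group_add) superalg \<Rightarrow> ('f, 'k::ab_group_add) superalg \<Rightarrow>
     ('f, 'k, 'e::ab_group_add, 'l) extension set set"
  where "extension_classes L K =
    {X. restricted_central_extension L K X} //
    {(X, Y). restricted_central_extension L K X \<and> restricted_central_extension L K Y \<and>
             equivalent_extensions X Y}"


section \<open>Restricted cohomology with trivial coefficients\<close>

text \<open>
  Of the coefficients \<open>M\<close> only the superspace structure is used. Hom is taken in the
  category of superspaces, so cochains preserve parity; accordingly the map \<open>\<omega>\<close>
  on $L_{\bar 0}$ has values in $M_{\bar 0}$. A linear map on $\bigwedge^2 L$ is a bilinear map
  on $L \times L$ vanishing on the defining relations.
\<close>

definition cochains1 ::
    "('f::field, 'l::ab_group_add) superalg \<Rightarrow> ('f, 'm::ab_group_add) superalg \<Rightarrow> ('l \<Rightarrow> 'm) set"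
  where "cochains1 L M = {\<phi>. even_linear L M \<phi>}"

definition cochains2 ::
    "('f::field, 'l::ab_group_add) superalg \<Rightarrow> ('f, 'm::ab_group_add) superalg \<Rightarrow> ('l \<Rightarrow> 'l \<Rightarrow> 'm) set"
  where "cochains2 L M = {\<alpha>. even_bilinear L M \<alpha> \<and> super_skew L \<alpha>}"

definition d1 :: "('f, 'l) superalg \<Rightarrow> ('l \<Rightarrow> 'm::ab_group_add) \<Rightarrow> 'l \<Rightarrow> 'l \<Rightarrow> 'm"
  where "d1 L \<phi> x y = - \<phi> (brk L x y)"

text \<open>The value on homogeneous arguments; \<open>i\<close>, \<open>j\<close>, \<open>k\<close> are their parities.\<close>

definition d2 ::
    "('f, 'l) superalg \<Rightarrow> ('l \<Rightarrow> 'l \<Rightarrow> 'm::ab_group_add) \<Rightarrow> bit \<times> 'l \<Rightarrow> bit \<times> 'l \<Rightarrow> bit \<times> 'l \<Rightarrow> 'm"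
  where "d2 L \<alpha> = (\<lambda>(i, x) (j, y) (k, z).
    - \<alpha> (brk L x y) z + koszul (j * k) (\<alpha> (brk L x z) y) - koszul (i * (j + k)) (\<alpha> (brk L y z) x))"

definition star_property ::
    "('f::field, 'l::ab_group_add) superalg \<Rightarrow> ('f, 'm::ab_group_add) superalg \<Rightarrow>
     ('l \<Rightarrow> 'l \<Rightarrow> 'm) \<Rightarrow> ('l \<Rightarrow> 'm) \<Rightarrow> bool"
  where "star_property L M \<phi> \<omega> \<longleftrightarrow>
    (\<forall>c. \<forall>x\<in>grade L 0. \<omega> (scl L c x) = scl M (c ^ CHAR('f)) (\<omega> x)) \<and>
    (\<forall>x\<in>grade L 0. \<forall>y\<in>grade L 0.
       \<omega> (x + y) = \<omega> x + \<omega> y + jsum (scl M) (\<lambda>xs. \<phi> (lbrk L (butlast xs)) (last xs)) x y)"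

text \<open>A map on $L_{\bar 0}$ is represented by its extension by \<open>0\<close>.\<close>

definition restr_cochains2 ::
    "('f::field, 'l::ab_group_add) superalg \<Rightarrow> ('f, 'm::ab_group_add) superalg \<Rightarrow>
     (('l \<Rightarrow> 'l \<Rightarrow> 'm) \<times> ('l \<Rightarrow> 'm)) set"
  where "restr_cochains2 L M =
    {(\<phi>, \<omega>). \<phi> \<in> cochains2 L M \<and> (\<forall>x\<in>grade L 0. \<omega> x \<in> grade M 0) \<and>
             (\<forall>x. x \<notin> grade L 0 \<longrightarrow> \<omega> x = 0) \<and> star_property L M \<phi> \<omega>}"

definition ind1 :: "('f, 'l) superalg \<Rightarrow> ('l \<Rightarrow> 'm::ab_group_add) \<Rightarrow> 'l \<Rightarrow> 'm"
  where "ind1 L \<phi> x = (if x \<in> grade L 0 then \<phi> (pmap L x) else 0)"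

text \<open>
  As \<open>d1\<close> is $-\varphi([x,y])$, the second component must carry the same sign: it is
  \<open>- ind1\<close>, not \<open>ind1\<close>, that has the $*$-property with respect to \<open>d1\<close>.
\<close>

definition restr_d1 ::
    "('f, 'l) superalg \<Rightarrow> ('l \<Rightarrow> 'm::ab_group_add) \<Rightarrow> ('l \<Rightarrow> 'l \<Rightarrow> 'm) \<times> ('l \<Rightarrow> 'm)"
  where "restr_d1 L \<phi> = (d1 L \<phi>, - ind1 L \<phi>)"

lemma restr_d1_in_restr_cochains2:
  fixes L :: "('f::field, 'l::ab_group_add) superalg" and M :: "('f, 'm::ab_group_add) superalg"
  assumes L: "restricted_lie_superalgebra L" and p: "CHAR('f) > 2" and \<phi>: "\<phi> \<in> cochains1 L M"
  shows "restr_d1 L \<phi> \<in> restr_cochains2 L M"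
proof -
  have lie: "lie_superalgebra L" and pm: "\<forall>x\<in>grade L 0. pmap L x \<in> grade L 0"
    and pms: "\<forall>c. \<forall>x\<in>grade L 0. pmap L (scl L c x) = scl L (c ^ CHAR('f)) (pmap L x)"
    and pma: "\<forall>x\<in>grade L 0. \<forall>y\<in>grade L 0.
       pmap L (x + y) = pmap L x + pmap L y + jsum (scl L) (lbrk L) x y"
    using L unfolding restricted_lie_superalgebra_def by auto
  have sup: "superspace L" and bil: "even_bilinear L L (brk L)" and skew: "super_skew L (brk L)"
    using lie unfolding lie_superalgebra_def by auto
  have lin: "Vector_Spaces.linear (scl L) (scl M) \<phi>" and ev: "\<forall>i. \<forall>x\<in>grade L i. \<phi> x \<in> grade M i"
    using \<phi> unfolding cochains1_def even_linear_def by auto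
  interpret l: Vector_Spaces.linear "scl L" "scl M" \<phi> by (rule lin)
  have sub: "l.vs1.subspace (grade L i)" for i using sup unfolding superspace_def by auto
  have sc: "scl L c x \<in> grade L 0" if "x \<in> grade L 0" for c x
    using sub that by (rule l.vs1.subspace_scale)
  have ad: "x + y \<in> grade L 0" if "x \<in> grade L 0" "y \<in> grade L 0" for x y
    using sub that by (rule l.vs1.subspace_add)
  have lneg: "Vector_Spaces.linear (scl L) (scl M) (\<lambda>x. - \<phi> (f x))"
    if "Vector_Spaces.linear (scl L) (scl L) f" for f
  proof -
    interpret f: Vector_Spaces.linear "scl L" "scl L" f by (rule that)
    show ?thesis
      by unfold_locales (auto simp: f.add f.scale l.add l.scale)
  qed
  have mneg: "- v \<in> grade M i" if "x \<in> grade L i" "v = \<phi> x" for x v i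
  proof -
    have "\<phi> (- x) \<in> grade M i" using ev l.vs1.subspace_neg[OF sub that(1)] by blast
    thus ?thesis using that(2) by (simp add: l.neg)
  qed
  have kos: "\<phi> (- koszul i v) = - koszul i (\<phi> v)" for i v
    by (auto simp: koszul_def l.neg)
  have kosneg: "koszul i (- v) = - koszul i v" for i and v :: 'm
    by (auto simp: koszul_def)
  have eb: "even_bilinear L M (d1 L \<phi>)"
  proof -
    have "- \<phi> (brk L x y) \<in> grade M (i + j)" if "x \<in> grade L i" "y \<in> grade L j" for i j x y
      using mneg[OF _ refl] bil that unfolding even_bilinear_def by blast
    moreover have "Vector_Spaces.linear (scl L) (scl M) (\<lambda>y. - \<phi> (brk L x y))" for x
      using bil by (intro lneg) (simp add: even_bilinear_def)
    moreover have "Vector_Spaces.linear (scl L) (scl M) (\<lambda>x. - \<phi> (brk L x y))" for y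
      using bil by (intro lneg) (simp add: even_bilinear_def)
    ultimately show ?thesis unfolding even_bilinear_def d1_def by blast
  qed
  have sk: "super_skew L (d1 L \<phi>)"
    unfolding super_skew_def
  proof (intro allI ballI)
    fix i j x y assume "x \<in> grade L i" "y \<in> grade L j"
    hence "brk L x y = - koszul (i * j) (brk L y x)"
      using skew unfolding super_skew_def by blast
    thus "d1 L \<phi> x y = - koszul (i * j) (d1 L \<phi> y x)"
      unfolding d1_def by (simp only: kos kosneg)
  qed
  have lb: "lbrk L xs = brk L (lbrk L (butlast xs)) (last xs)" if two: "length xs \<ge> 2" for xs
  proof -
    obtain a ys z where "xs = a # ys @ [z]"
      using two by (cases xs; cases "tl xs" rule: rev_cases) auto
    thus ?thesis by (simp add: lbrk_def butlast_append)
  qed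
  have js: "\<phi> (jsum (scl L) (lbrk L) x y) =
      - jsum (scl M) (\<lambda>xs. d1 L \<phi> (lbrk L (butlast xs)) (last xs)) x y" for x y
  proof -
    have "\<phi> (jsum (scl L) (lbrk L) x y) =
      (\<Sum>bs | length bs = CHAR('f) \<and> bs ! 0 = True \<and> bs ! 1 = False.
       scl M (1 / of_nat (count_list bs True)) (\<phi> (lbrk L (map (\<lambda>b. if b then x else y) bs))))"
      by (simp add: jsum_def l.sum l.scale)
    also have "\<dots> = (\<Sum>bs | length bs = CHAR('f) \<and> bs ! 0 = True \<and> bs ! 1 = False.
       - scl M (1 / of_nat (count_list bs True))
         (d1 L \<phi> (lbrk L (butlast (map (\<lambda>b. if b then x else y) bs)))
            (last (map (\<lambda>b. if b then x else y) bs))))"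
    proof (rule sum.cong[OF refl])
      fix bs :: "bool list"
      assume "bs \<in> {bs. length bs = CHAR('f) \<and> bs ! 0 = True \<and> bs ! 1 = False}"
      hence "length (map (\<lambda>b. if b then x else y) bs) \<ge> 2" using p by simp
      from lb[OF this] show "scl M (1 / of_nat (count_list bs True))
           (\<phi> (lbrk L (map (\<lambda>b. if b then x else y) bs))) =
         - scl M (1 / of_nat (count_list bs True))
         (d1 L \<phi> (lbrk L (butlast (map (\<lambda>b. if b then x else y) bs)))
            (last (map (\<lambda>b. if b then x else y) bs)))"
        by (simp add: d1_def l.vs2.scale_minus_right)
    qed
    finally show ?thesis by (simp add: jsum_def sum_negf)
  qed
  have st: "star_property L M (d1 L \<phi>) (- ind1 L \<phi>)"
    unfolding star_property_def
    using pms pma sc ad js by (auto simp: ind1_def l.add l.scale l.vs2.scale_minus_right)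
  have vals: "- ind1 L \<phi> x \<in> grade M 0" if "x \<in> grade L 0" for x
    using pm mneg that by (auto simp: ind1_def)
  show ?thesis
    using eb sk st vals unfolding restr_cochains2_def restr_d1_def cochains2_def
    by (auto simp: ind1_def)
qed

definition ind2 ::
    "('f::field, 'l) superalg \<Rightarrow> ('l \<Rightarrow> 'l \<Rightarrow> 'm::ab_group_add) \<times> ('l \<Rightarrow> 'm) \<Rightarrow> 'l \<Rightarrow> 'l \<Rightarrow> 'm"
  where "ind2 L = (\<lambda>(\<alpha>, \<beta>) x y.
    \<alpha> x (pmap L y) - \<alpha> (lbrk L (x # replicate (CHAR('f) - 1) y)) y)"

text \<open>
  In \<open>ind2\<close> the second argument is even, the first one arbitrary: for odd \<open>x\<close> the
  condition says that the odd part of the extension is a restricted module. If $M_{\bar 1} = 0$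
  it is automatic there (see \<open>restr_cocycles2_purely_even\<close> below).
\<close>

definition restr_cocycles2 ::
    "('f::field, 'l::ab_group_add) superalg \<Rightarrow> ('f, 'm::ab_group_add) superalg \<Rightarrow>
     (('l \<Rightarrow> 'l \<Rightarrow> 'm) \<times> ('l \<Rightarrow> 'm)) set"
  where "restr_cocycles2 L M =
    {c \<in> restr_cochains2 L M.
       (\<forall>i j k. \<forall>x\<in>grade L i. \<forall>y\<in>grade L j. \<forall>z\<in>grade L k. d2 L (fst c) (i, x) (j, y) (k, z) = 0) \<and>
       (\<forall>x. \<forall>y\<in>grade L 0. ind2 L c x y = 0)}"

lemma restr_cocycles2_purely_even:
  fixes L :: "('f::field, 'l::ab_group_add) superalg" and M :: "('f, 'm::ab_group_add) superalg"
  assumes L: "restricted_lie_superalgebra L" and M: "grade M 1 = {0}"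
  shows "restr_cocycles2 L M =
    {c \<in> restr_cochains2 L M.
       (\<forall>i j k. \<forall>x\<in>grade L i. \<forall>y\<in>grade L j. \<forall>z\<in>grade L k. d2 L (fst c) (i, x) (j, y) (k, z) = 0) \<and>
       (\<forall>x\<in>grade L 0. \<forall>y\<in>grade L 0. ind2 L c x y = 0)}"
proof -
  have "ind2 L (\<alpha>, \<beta>) x y = 0"
    if c: "(\<alpha>, \<beta>) \<in> restr_cochains2 L M" and y: "y \<in> grade L 0"
      and ev: "\<forall>x\<in>grade L 0. \<forall>y\<in>grade L 0. ind2 L (\<alpha>, \<beta>) x y = 0" for \<alpha> \<beta> x y
  proof -
    have lie: "lie_superalgebra L" and pm: "pmap L y \<in> grade L 0"
      using L y unfolding restricted_lie_superalgebra_def by auto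
    have sup: "superspace L" and bil: "even_bilinear L L (brk L)"
      using lie unfolding lie_superalgebra_def by auto
    have al: "even_bilinear L M \<alpha>" using c unfolding restr_cochains2_def cochains2_def by auto
    obtain a b where ab: "a \<in> grade L 0" "b \<in> grade L 1" "x = a + b"
      using sup unfolding superspace_def by blast
    have add: "f (u + v) w = f u w + f v w" if "even_bilinear L N f"
      for N :: "('f, 'n::ab_group_add) superalg" and f u v w
    proof -
      have "Vector_Spaces.linear (scl L) (scl N) (\<lambda>u. f u w)"
        using that unfolding even_bilinear_def by auto
      then interpret f: Vector_Spaces.linear "scl L" "scl N" "\<lambda>u. f u w" .
      show ?thesis by (rule f.add)
    qed
    have fold: "lbrk L ((u + v) # replicate n y) = lbrk L (u # replicate n y) + lbrk L (v # replicate n y)"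
      for u v n
      by (induction n arbitrary: u v) (simp_all add: lbrk_def add[OF bil])
    have odd: "lbrk L (u # replicate n y) \<in> grade L 1" if "u \<in> grade L 1" for u n
      using that
    proof (induction n arbitrary: u)
      case (Suc n)
      have "brk L u y \<in> grade L (1 + 0)" using bil y Suc.prems unfolding even_bilinear_def by blast
      thus ?case using Suc.IH[of "brk L u y"] by (simp add: lbrk_def)
    qed (simp add: lbrk_def)
    have z: "\<alpha> u w = 0" if "u \<in> grade L 1" "w \<in> grade L 0" for u w
    proof -
      have "\<alpha> u w \<in> grade M (1 + 0)" using al that unfolding even_bilinear_def by blast
      thus ?thesis using M by simp
    qed
    have "ind2 L (\<alpha>, \<beta>) x y = ind2 L (\<alpha>, \<beta>) a y + ind2 L (\<alpha>, \<beta>) b y"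
      by (simp add: ind2_def ab(3) fold add[OF al])
    moreover have "ind2 L (\<alpha>, \<beta>) b y = 0"
      using z[OF ab(2) pm] z[OF odd[OF ab(2)] y] by (simp add: ind2_def)
    ultimately show ?thesis using ev ab(1) y by simp
  qed
  thus ?thesis unfolding restr_cocycles2_def by auto
qed

definition restr_coboundaries2 ::
    "('f::field, 'l::ab_group_add) superalg \<Rightarrow> ('f, 'm::ab_group_add) superalg \<Rightarrow>
     (('l \<Rightarrow> 'l \<Rightarrow> 'm) \<times> ('l \<Rightarrow> 'm)) set"
  where "restr_coboundaries2 L M = restr_d1 L ` cochains1 L M"

definition restr_cohomology2 ::
    "('f::field, 'l::ab_group_add) superalg \<Rightarrow> ('f, 'm::ab_group_add) superalg \<Rightarrow>
     (('l \<Rightarrow> 'l \<Rightarrow> 'm) \<times> ('l \<Rightarrow> 'm)) set set"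
  where "restr_cohomology2 L M =
    restr_cocycles2 L M //
    {(c, c'). c \<in> restr_cocycles2 L M \<and> c' \<in> restr_cocycles2 L M \<and>
              c - c' \<in> restr_coboundaries2 L M}"

end

theory Submission
  imports Defs
begin

text \<open>
  A central extension \<open>E\<close> of \<open>L\<close> by \<open>K\<close> has an even linear section \<open>s\<close>, and
  $(x, k) \mapsto s x + \iota k$ identifies \<open>E\<close> with \<open>L \<times> K\<close>. As \<open>K\<close> is central and
  strongly abelian, the bracket becomes $[(x,k),(y,l)] = ([x,y], \alpha(x,y))$ and the \<open>p\<close>-map
  $(x,k)^{[p]} = (x^{[p]}, \beta(x))$, where \<open>\<alpha>\<close> and \<open>\<beta>\<close> measure the failure of \<open>s\<close> to be a
  homomorphism. Axiom by axiom, this product is a restricted Lie superalgebra exactly when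
  $(\alpha,\beta)$ is a restricted cocycle. An equivalence of two such products has the form
  $(x,k) \mapsto (x, k + \varphi(x))$, and it is a homomorphism exactly when the two cocycles differ
  by the coboundary of $\varphi$.
\<close>

subsection \<open>Elementary forms of the definitions\<close>

text \<open>The predicate \<open>module.subspace\<close> can be unfolded only over a vector space;
  when \<open>scl A\<close> is not one, both sides are false. This form lets products and the ground
  field be checked by direct computation.\<close>

lemma superspace_iff:
  "superspace A \<longleftrightarrow> vector_space (scl A) \<and>
    (\<forall>i. 0 \<in> grade A i \<and> (\<forall>x\<in>grade A i. \<forall>y\<in>grade A i. x + y \<in> grade A i) \<and>
         (\<forall>c. \<forall>x\<in>grade A i. scl A c x \<in> grade A i)) \<and>
    grade A 0 \<inter> grade A 1 = {0} \<and>
    (\<forall>x. \<exists>a\<in>grade A 0. \<exists>b\<in>grade A 1. x = a + b)"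
proof (cases "vector_space (scl A)")
  case True
  then interpret vector_space "scl A" .
  show ?thesis unfolding superspace_def subspace_def using True by auto
qed (simp add: superspace_def)

lemma superspace_vector_space: "superspace A \<Longrightarrow> vector_space (scl A)"
  by (simp add: superspace_def)

lemma superspace_subspace: "superspace A \<Longrightarrow> module.subspace (scl A) (grade A i)"
  by (simp add: superspace_def)

lemma superspace_zero: "superspace A \<Longrightarrow> 0 \<in> grade A i"
  and superspace_add: "superspace A \<Longrightarrow> x \<in> grade A i \<Longrightarrow> y \<in> grade A i \<Longrightarrow> x + y \<in> grade A i"
  and superspace_scl: "superspace A \<Longrightarrow> x \<in> grade A i \<Longrightarrow> scl A c x \<in> grade A i"
  by (simp_all add: superspace_iff)

lemma superspace_diff:
  assumes "superspace A" "x \<in> grade A i" "y \<in> grade A i"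
  shows "x - y \<in> grade A i"
proof -
  interpret vector_space "scl A" using assms(1) by (rule superspace_vector_space)
  show ?thesis using superspace_subspace[OF assms(1)] assms(2,3) by (rule subspace_diff)
qed

lemma superspace_decomp:
  assumes "superspace A"
  obtains a b where "a \<in> grade A 0" "b \<in> grade A 1" "x = a + b"
  using assms unfolding superspace_def by blast

text \<open>The difference of two decompositions is both even and odd, hence zero.\<close>

lemma superspace_decomp_unique:
  assumes A: "superspace A"
    and "a \<in> grade A 0" "a' \<in> grade A 0" "b \<in> grade A 1" "b' \<in> grade A 1" "a + b = a' + b'"
  shows "a = a' \<and> b = b'"
proof -
  have "a - a' = b' - b" using assms(6) by (simp add: algebra_simps)
  moreover have "a - a' \<in> grade A 0" "b' - b \<in> grade A 1"
    using A assms(2-5) by (auto intro: superspace_diff)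
  ultimately have "a - a' \<in> grade A 0 \<inter> grade A 1" by simp
  hence "a - a' = 0" using A unfolding superspace_def by blast
  thus ?thesis using assms(6) by simp
qed

section \<open>Even linear and bilinear maps\<close>

lemma even_linear_iff:
  "even_linear A B f \<longleftrightarrow> vector_space (scl A) \<and> vector_space (scl B) \<and>
    (\<forall>x y. f (x + y) = f x + f y) \<and> (\<forall>c x. f (scl A c x) = scl B c (f x)) \<and>
    (\<forall>i. \<forall>x\<in>grade A i. f x \<in> grade B i)"
  unfolding even_linear_def Vector_Spaces.linear_iff by blast

lemma even_bilinear_iff:
  "even_bilinear A B f \<longleftrightarrow> vector_space (scl A) \<and> vector_space (scl B) \<and>
    (\<forall>x y z. f x (y + z) = f x y + f x z) \<and> (\<forall>x y z. f (x + y) z = f x z + f y z) \<and>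
    (\<forall>c x y. f x (scl A c y) = scl B c (f x y)) \<and> (\<forall>c x y. f (scl A c x) y = scl B c (f x y)) \<and>
    (\<forall>i j. \<forall>x\<in>grade A i. \<forall>y\<in>grade A j. f x y \<in> grade B (i + j))"
  unfolding even_bilinear_def Vector_Spaces.linear_iff by blast

lemma even_bilinear_add:
  "even_bilinear A B f \<Longrightarrow> f x (y + z) = f x y + f x z"
  "even_bilinear A B f \<Longrightarrow> f (x + y) z = f x z + f y z"
  by (simp_all add: even_bilinear_iff)

lemma even_bilinear_scl:
  "even_bilinear A B f \<Longrightarrow> f x (scl A c y) = scl B c (f x y)"
  "even_bilinear A B f \<Longrightarrow> f (scl A c x) y = scl B c (f x y)"
  by (simp_all add: even_bilinear_iff)

lemma even_bilinear_grade:
  "even_bilinear A B f \<Longrightarrow> x \<in> grade A i \<Longrightarrow> y \<in> grade A j \<Longrightarrow> f x y \<in> grade B (i + j)"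
  unfolding even_bilinear_iff by blast

lemma even_bilinear_zero:
  assumes "even_bilinear A B f"
  shows "f x 0 = 0" "f 0 y = 0"
  using even_bilinear_add[OF assms, of x 0 0] even_bilinear_add(2)[OF assms, of 0 0 y] by simp_all

lemma even_bilinear_minus:
  assumes "even_bilinear A B f"
  shows "f x (- y) = - f x y" "f (- x) y = - f x y"
proof -
  have "f x y + f x (- y) = 0" "f x y + f (- x) y = 0"
    by (simp_all flip: even_bilinear_add[OF assms] add: even_bilinear_zero[OF assms])
  thus "f x (- y) = - f x y" "f (- x) y = - f x y"
    by (simp_all add: eq_neg_iff_add_eq_0 add.commute)
qed

lemma even_linear_zero:
  assumes "even_linear A B f"
  shows "f 0 = 0"
proof -
  have "f (0 + 0) = f 0 + f 0" using assms unfolding even_linear_iff by blast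
  thus ?thesis by simp
qed

lemma even_linear_neg:
  assumes "even_linear A B f"
  shows "f (- x) = - f x"
proof -
  have "f (x + - x) = f x + f (- x)" using assms unfolding even_linear_iff by blast
  thus ?thesis by (simp add: even_linear_zero[OF assms] eq_neg_iff_add_eq_0 add.commute)
qed

lemma even_linear_diff:
  assumes "even_linear A B f"
  shows "f (x - y) = f x - f y"
proof -
  have "f (x + - y) = f x + f (- y)" using assms unfolding even_linear_iff by blast
  thus ?thesis by (simp add: even_linear_neg[OF assms])
qed

lemma even_linear_sum:
  assumes "even_linear A B f"
  shows "f (sum g S) = (\<Sum>i\<in>S. f (g i))"
proof -
  interpret f: Vector_Spaces.linear "scl A" "scl B" f using assms unfolding even_linear_def by blast
  show ?thesis by (rule f.sum)
qed

lemma restricted_lie_superspace: "restricted_lie_superalgebra A \<Longrightarrow> superspace A"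
  and restricted_lie_lie: "restricted_lie_superalgebra A \<Longrightarrow> lie_superalgebra A"
  and restricted_lie_pmap: "restricted_lie_superalgebra A \<Longrightarrow> x \<in> grade A 0 \<Longrightarrow> pmap A x \<in> grade A 0"
  and restricted_lie_bilinear: "restricted_lie_superalgebra A \<Longrightarrow> even_bilinear A A (brk A)"
  and restricted_lie_skew: "restricted_lie_superalgebra A \<Longrightarrow> super_skew A (brk A)"
  unfolding restricted_lie_superalgebra_def lie_superalgebra_def by blast+

text \<open>The Koszul sign depends on the product of the parities, which is zero as soon as one
  argument is even. Splitting \<open>y\<close> into its parts therefore gives ordinary skew-symmetry
  even for inhomogeneous \<open>y\<close>.\<close>

lemma super_skew_even:
  assumes A: "superspace A" and f: "even_bilinear A B f" "super_skew A f" and x: "x \<in> grade A 0"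
  shows "f x y = - f y x"
proof -
  obtain a b where ab: "a \<in> grade A 0" "b \<in> grade A 1" "y = a + b"
    using A by (rule superspace_decomp)
  have "f x a = - koszul (0 * 0) (f a x)" "f x b = - koszul (0 * 1) (f b x)"
    using f(2) x ab(1,2) unfolding super_skew_def by blast+
  thus ?thesis by (simp add: ab(3) even_bilinear_add[OF f(1)] koszul_def)
qed

section \<open>Left-normed brackets and Jacobson's sum\<close>

lemma lbrk_snoc:
  assumes "length xs \<ge> 2"
  shows "lbrk A xs = brk A (lbrk A (butlast xs)) (last xs)"
proof -
  obtain a ys z where "xs = a # ys @ [z]"
    using assms by (cases xs; cases "tl xs" rule: rev_cases) auto
  thus ?thesis by (simp add: lbrk_def butlast_append)
qed

lemma lbrk_map:
  assumes "\<And>x y. f (brk A x y) = brk B (f x) (f y)" "xs \<noteq> []"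
  shows "f (lbrk A xs) = lbrk B (map f xs)"
proof -
  obtain a ys where xs: "xs = a # ys" using assms(2) by (cases xs) auto
  have "f (foldl (brk A) a ys) = foldl (brk B) (f a) (map f ys)"
    by (induction ys arbitrary: a) (auto simp: assms(1))
  thus ?thesis by (simp add: lbrk_def xs)
qed

text \<open>The index set consists of formal Boolean words, independent of the letters put in. Sums
  in different letters, even of different types, can thus be compared term by term.\<close>

lemma jsum_cong:
  fixes s :: "'f::field \<Rightarrow> 'b \<Rightarrow> 'b::ab_group_add"
  assumes "\<And>bs. length bs = CHAR('f) \<Longrightarrow> bs ! 0 \<Longrightarrow> \<not> bs ! 1 \<Longrightarrow>
    g (map (\<lambda>b. if b then x else y) bs) = h (map (\<lambda>b. if b then x' else y') bs)"
  shows "jsum s g x y = jsum s h x' y'"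
  unfolding jsum_def by (intro sum.cong refl arg_cong[where f = "s _"] assms) auto

lemma jsum_eq_0:
  fixes s :: "'f::field \<Rightarrow> 'b \<Rightarrow> 'b::ab_group_add"
  assumes "vector_space s"
    and "\<And>bs. length bs = CHAR('f) \<Longrightarrow> bs ! 0 \<Longrightarrow> \<not> bs ! 1 \<Longrightarrow>
      g (map (\<lambda>b. if b then x else y) bs) = 0"
  shows "jsum s g x y = 0"
proof -
  interpret vector_space s by fact
  show ?thesis unfolding jsum_def by (intro sum.neutral) (auto simp: assms(2))
qed

lemma even_linear_jsum:
  fixes A :: "('f::field, 'a::ab_group_add) superalg" and B :: "('f, 'b::ab_group_add) superalg"
  assumes f: "even_linear A B f"
  shows "f (jsum (scl A) g x y) = jsum (scl B) (\<lambda>xs. f (g xs)) x y"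
proof -
  have "f (scl A c v) = scl B c (f v)" for c v using f unfolding even_linear_iff by blast
  thus ?thesis by (simp add: jsum_def even_linear_sum[OF f])
qed

subsection \<open>Restricted homomorphisms\<close>

lemma restricted_homD:
  assumes "restricted_hom A B f"
  shows "even_linear A B f" "f (brk A x y) = brk B (f x) (f y)"
    "x \<in> grade A 0 \<Longrightarrow> f (pmap A x) = pmap B (f x)"
    "x \<in> grade A i \<Longrightarrow> f x \<in> grade B i"
  using assms unfolding restricted_hom_def even_linear_def by auto

text \<open>If \<open>f x\<close> has parity \<open>i\<close>, uniqueness of the decomposition in
  \<open>B\<close> forces the image of the other component of \<open>x\<close> to vanish, and
  injectivity kills that component. This reflection of parity is what makes inverses even and lets
  graded axioms be pulled back.\<close>

lemma even_linear_grade_iff: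
  assumes A: "superspace A" and B: "superspace B" and f: "even_linear A B f" "inj f"
  shows "f x \<in> grade B i \<longleftrightarrow> x \<in> grade A i"
proof
  assume fx: "f x \<in> grade B i"
  obtain a b where ab: "a \<in> grade A 0" "b \<in> grade A 1" "x = a + b"
    using A by (rule superspace_decomp)
  have gr: "f a \<in> grade B 0" "f b \<in> grade B 1" and ad: "f x = f a + f b"
    using f(1) ab unfolding even_linear_iff by auto
  have z: "u = 0" if "f u = 0" for u
    using that f(2) even_linear_zero[OF f(1)] by (metis injD)
  show "x \<in> grade A i"
  proof (cases "i = 0")
    case True
    have "f x = f a \<and> 0 = f b"
      using superspace_decomp_unique[OF B _ gr(1) superspace_zero[OF B] gr(2)] fx True ad by simp
    thus ?thesis using z[of b] ab True by simp
  next
    case False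
    hence i: "i = 1" by simp
    have "0 = f a \<and> f x = f b"
      using superspace_decomp_unique[OF B superspace_zero[OF B] gr(1) _ gr(2)] fx i ad by simp
    thus ?thesis using z[of a] ab i by simp
  qed
next
  assume "x \<in> grade A i"
  thus "f x \<in> grade B i" using f(1) unfolding even_linear_iff by auto
qed

lemma restricted_hom_id: "superspace A \<Longrightarrow> restricted_hom A A id"
  by (simp add: restricted_hom_def even_linear_iff superspace_vector_space)

lemma restricted_hom_comp:
  "restricted_hom A B f \<Longrightarrow> restricted_hom B C g \<Longrightarrow> restricted_hom A C (g \<circ> f)"
  unfolding restricted_hom_def even_linear_iff by auto

lemma restricted_hom_inv:
  assumes A: "restricted_lie_superalgebra A" and B: "superspace B"
    and f: "restricted_hom A B f" and bij: "bij f"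
  shows "restricted_hom B A (inv f)"
proof -
  have fi: "f (inv f y) = y" for y using bij by (simp add: bij_is_surj surj_f_inv_f)
  have eqI: "inv f y = x" if "f x = y" for x y using bij that by (metis bij_inv_eq_iff)
  have gr: "inv f y \<in> grade A i \<longleftrightarrow> y \<in> grade B i" for y i
    using even_linear_grade_iff[OF restricted_lie_superspace[OF A] B restricted_homD(1)[OF f]
        bij_is_inj[OF bij], of "inv f y" i] fi by simp
  have lin: "vector_space (scl A)" "vector_space (scl B)"
    "f (x + y) = f x + f y" "f (scl A c x) = scl B c (f x)" for x y c
    using restricted_homD(1)[OF f] unfolding even_linear_iff by auto
  show ?thesis
    unfolding restricted_hom_def even_linear_iff
    by (auto simp: lin fi gr restricted_homD[OF f] intro!: eqI)
qed

text \<open>Each axiom is an equation or a membership in a graded part. An injective homomorphism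
  reflects equations, and parity by \<open>even_linear_grade_iff\<close>, so every axiom of
  \<open>B\<close> descends to \<open>A\<close>. Applied to a product mapping into an extension,
  this replaces a direct verification of the cocycle identities.\<close>

lemma restricted_lie_superalgebra_pullback:
  fixes A :: "('f::field, 'a::ab_group_add) superalg" and B :: "('f, 'b::ab_group_add) superalg"
  assumes A: "superspace A" and B: "restricted_lie_superalgebra B"
    and f: "restricted_hom A B f" and inj: "inj f" and p: "CHAR('f) > 0"
  shows "restricted_lie_superalgebra A"
proof -
  have sB: "superspace B" using B by (rule restricted_lie_superspace)
  note fl = restricted_homD(1)[OF f]
  have gr: "x \<in> grade A i \<longleftrightarrow> f x \<in> grade B i" for x i
    using even_linear_grade_iff[OF A sB fl inj] by simp
  have eq: "x = y \<longleftrightarrow> f x = f y" for x y using inj by (metis injD)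
  have add: "f (x + y) = f x + f y" and sc: "f (scl A c x) = scl B c (f x)" for x y c
    using fl unfolding even_linear_iff by auto
  have br: "f (brk A x y) = brk B (f x) (f y)" for x y using restricted_homD(2)[OF f] .
  have kos: "f (koszul i x) = koszul i (f x)" for i x
    by (simp add: koszul_def even_linear_neg[OF fl])
  have pm: "f (pmap A x) = pmap B (f x)" if "f x \<in> grade B 0" for x
    using restricted_homD(3)[OF f] that gr by blast
  have fp: "f ((brk A x ^^ n) y) = (brk B (f x) ^^ n) (f y)" for x y n
    by (induction n) (simp_all add: br)
  have js: "f (jsum (scl A) (lbrk A) x y) = jsum (scl B) (lbrk B) (f x) (f y)" for x y
    unfolding even_linear_jsum[OF fl]
  proof (rule jsum_cong)
    fix bs :: "bool list" assume "length bs = CHAR('f)"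
    \<comment> \<open>Positive characteristic makes the words nonempty; \<open>lbrk\<close> has no
      meaningful value on the empty list.\<close>
    hence "map (\<lambda>b. if b then x else y) bs \<noteq> []" using p by auto
    thus "f (lbrk A (map (\<lambda>b. if b then x else y) bs)) =
        lbrk B (map (\<lambda>b. if b then f x else f y) bs)"
      by (subst lbrk_map[where f = f and B = B]) (auto simp: br if_distrib o_def cong: if_cong)
  qed
  have vs: "vector_space (scl A)" using A by (rule superspace_vector_space)
  note bB = restricted_lie_bilinear[OF B]
  have "brk A x (y + z) = brk A x y + brk A x z" "brk A (x + y) z = brk A x z + brk A y z"
    "brk A x (scl A c y) = scl A c (brk A x y)" "brk A (scl A c x) y = scl A c (brk A x y)" for x y z c
    unfolding eq by (simp_all only: br add sc even_bilinear_scl[OF bB] even_bilinear_add[OF bB])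
  moreover have "brk A x y \<in> grade A (i + j)" if "x \<in> grade A i" "y \<in> grade A j" for x y i j
    using that unfolding gr br by (rule even_bilinear_grade[OF bB])
  ultimately have bil: "even_bilinear A A (brk A)" using vs unfolding even_bilinear_iff by blast
  have "brk A x y = - koszul (i * j) (brk A y x)"
    if "x \<in> grade A i" "y \<in> grade A j" for i j x y
    unfolding eq br even_linear_neg[OF fl] kos
    using restricted_lie_skew[OF B] that unfolding super_skew_def gr by blast
  hence "super_skew A (brk A)" unfolding super_skew_def by blast
  moreover have "brk A x (brk A y z) = brk A (brk A x y) z + koszul (i * j) (brk A y (brk A x z))"
    if "x \<in> grade A i" "y \<in> grade A j" "z \<in> grade A k" for i j k x y z
    unfolding eq br add kos
    using restricted_lie_lie[OF B] that unfolding lie_superalgebra_def gr by blast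
  ultimately have "lie_superalgebra A" using A bil unfolding lie_superalgebra_def by blast
  moreover have "pmap A x \<in> grade A 0" if "x \<in> grade A 0" for x
    using restricted_lie_pmap[OF B] that unfolding gr by (simp add: pm)
  moreover have "pmap A (scl A c x) = scl A (c ^ CHAR('f)) (pmap A x)" if "x \<in> grade A 0" for c x
  proof -
    have "pmap B (scl B c (f x)) = scl B (c ^ CHAR('f)) (pmap B (f x))"
      using B that unfolding restricted_lie_superalgebra_def gr by blast
    thus ?thesis using that unfolding eq gr by (simp add: sc pm superspace_scl[OF sB])
  qed
  moreover have "pmap A (x + y) = pmap A x + pmap A y + jsum (scl A) (lbrk A) x y"
    if "x \<in> grade A 0" "y \<in> grade A 0" for x y
  proof -
    have "pmap B (f x + f y) = pmap B (f x) + pmap B (f y) + jsum (scl B) (lbrk B) (f x) (f y)"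
      using B that unfolding restricted_lie_superalgebra_def gr by blast
    thus ?thesis using that unfolding eq gr by (simp add: add pm js superspace_add[OF sB])
  qed
  moreover have "brk A (pmap A x) y = (brk A x ^^ CHAR('f)) y"
    if "x \<in> grade A 0" "y \<in> grade A 0 \<or> y \<in> grade A 1" for x y
  proof -
    have "brk B (pmap B (f x)) (f y) = (brk B (f x) ^^ CHAR('f)) (f y)"
      using B that unfolding restricted_lie_superalgebra_def gr by blast
    thus ?thesis using that unfolding eq gr by (simp add: br pm fp)
  qed
  ultimately show ?thesis unfolding restricted_lie_superalgebra_def by blast
qed

subsection \<open>The extension attached to a cochain\<close>

text \<open>The pair \<open>c\<close> is arbitrary, so that the axioms of the product can be
  translated into conditions on \<open>c\<close>. Bracket and \<open>p\<close>-map ignore the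
  \<open>K\<close>-coordinates of their arguments, as befits a central, strongly abelian
  kernel.\<close>

definition twisted_prod ::
    "('f::field, 'l::ab_group_add) superalg \<Rightarrow> ('f, 'k::ab_group_add) superalg \<Rightarrow>
     ('l \<Rightarrow> 'l \<Rightarrow> 'k) \<times> ('l \<Rightarrow> 'k) \<Rightarrow> ('f, 'l \<times> 'k) superalg"
  where "twisted_prod L K c =
    \<lparr>scl = (\<lambda>r u. (scl L r (fst u), scl K r (snd u))),
     grade = (\<lambda>i. grade L i \<times> grade K i),
     brk = (\<lambda>u v. (brk L (fst u) (fst v), fst c (fst u) (fst v))),
     pmap = (\<lambda>u. (pmap L (fst u), snd c (fst u)))\<rparr>"

lemma twisted_prod_simps [simp]:
  "scl (twisted_prod L K c) r u = (scl L r (fst u), scl K r (snd u))"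
  "grade (twisted_prod L K c) i = grade L i \<times> grade K i"
  "brk (twisted_prod L K c) u v = (brk L (fst u) (fst v), fst c (fst u) (fst v))"
  "pmap (twisted_prod L K c) u = (pmap L (fst u), snd c (fst u))"
  by (simp_all add: twisted_prod_def)

lemma superspace_twisted_prod:
  assumes L: "superspace L" and K: "superspace K"
  shows "superspace (twisted_prod L K c)"
proof -
  interpret l: vector_space "scl L" using L by (rule superspace_vector_space)
  interpret k: vector_space "scl K" using K by (rule superspace_vector_space)
  have vs: "vector_space (scl (twisted_prod L K c))"
    by unfold_locales
      (auto simp: l.scale_right_distrib k.scale_right_distrib l.scale_left_distrib k.scale_left_distrib)
  have dec: "\<exists>a\<in>grade L 0 \<times> grade K 0. \<exists>b\<in>grade L 1 \<times> grade K 1. (x, y) = a + b" for x y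
  proof -
    obtain a b where "a \<in> grade L 0" "b \<in> grade L 1" "x = a + b"
      using L by (rule superspace_decomp)
    moreover obtain a' b' where "a' \<in> grade K 0" "b' \<in> grade K 1" "y = a' + b'"
      using K by (rule superspace_decomp)
    ultimately show ?thesis
      by (intro bexI[of _ "(a, a')"] bexI[of _ "(b, b')"]) auto
  qed
  have "grade L 0 \<inter> grade L 1 = {0}" "grade K 0 \<inter> grade K 1 = {0}"
    using L K unfolding superspace_def by blast+
  hence "(grade L 0 \<times> grade K 0) \<inter> (grade L 1 \<times> grade K 1) = {0}"
    by (simp add: Times_Int_Times zero_prod_def)
  thus ?thesis
    unfolding superspace_iff using vs dec
    by (auto simp: zero_prod_def superspace_zero[OF L] superspace_zero[OF K] superspace_add[OF L]
      superspace_add[OF K] superspace_scl[OF L] superspace_scl[OF K])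
qed

lemma koszul_pair: "koszul i (x, y) = (koszul i x, koszul i y)"
  by (simp add: koszul_def)

text \<open>The \<open>L\<close>-coordinate is bilinear by assumption, so only the
  \<open>K\<close>-coordinate matters, and it is recovered by evaluation on pairs
  \<open>(x, 0)\<close>. The later comparisons of axioms follow the same pattern.\<close>

lemma even_bilinear_twisted_prod:
  assumes L: "superspace L" and K: "superspace K" and br: "even_bilinear L L (brk L)"
  shows "even_bilinear (twisted_prod L K c) (twisted_prod L K c) (brk (twisted_prod L K c)) \<longleftrightarrow>
    even_bilinear L K (fst c)"
proof
  assume r: "even_bilinear L K (fst c)"
  have gr: "brk (twisted_prod L K c) u v \<in> grade (twisted_prod L K c) (i + j)"
    if "u \<in> grade (twisted_prod L K c) i" "v \<in> grade (twisted_prod L K c) j" for i j u v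
  proof -
    have "fst u \<in> grade L i" "fst v \<in> grade L j" using that by auto
    hence "brk L (fst u) (fst v) \<in> grade L (i + j)" "fst c (fst u) (fst v) \<in> grade K (i + j)"
      using even_bilinear_grade[OF br] even_bilinear_grade[OF r] by blast+
    \<comment> \<open>Removing \<open>add_bit_eq_xor\<close> keeps the parity in the form
      \<open>i + j\<close>, in which both memberships are stated.\<close>
    thus ?thesis by (simp del: add_bit_eq_xor)
  qed
  have "brk (twisted_prod L K c) u (scl (twisted_prod L K c) a v) =
      scl (twisted_prod L K c) a (brk (twisted_prod L K c) u v)"
    "brk (twisted_prod L K c) (scl (twisted_prod L K c) a u) v =
      scl (twisted_prod L K c) a (brk (twisted_prod L K c) u v)" for u v a
    by (simp_all add: even_bilinear_scl[OF br] even_bilinear_scl[OF r])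
  moreover have "brk (twisted_prod L K c) u (v + w) =
      brk (twisted_prod L K c) u v + brk (twisted_prod L K c) u w"
    "brk (twisted_prod L K c) (u + v) w =
      brk (twisted_prod L K c) u w + brk (twisted_prod L K c) v w" for u v w
    by (simp_all add: even_bilinear_add[OF br] even_bilinear_add[OF r])
  ultimately show "even_bilinear (twisted_prod L K c) (twisted_prod L K c) (brk (twisted_prod L K c))"
    using gr superspace_vector_space[OF superspace_twisted_prod[OF L K]]
    unfolding even_bilinear_iff by blast
next
  let ?T = "twisted_prod L K c"
  assume l: "even_bilinear ?T ?T (brk ?T)"
  have "fst c x y \<in> grade K (i + j)" if "x \<in> grade L i" "y \<in> grade L j" for x y i j
  proof -
    have "(x, 0) \<in> grade ?T i" "(y, 0) \<in> grade ?T j" using that superspace_zero[OF K] by simp_all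
    hence "brk ?T (x, 0) (y, 0) \<in> grade ?T (i + j)"
      using l unfolding even_bilinear_iff by blast
    thus ?thesis by (simp del: add_bit_eq_xor)
  qed
  moreover have "fst c x (y + z) = fst c x y + fst c x z" "fst c (x + y) z = fst c x z + fst c y z"
    for x y z
    using even_bilinear_add(1)[OF l, of "(x, 0)" "(y, 0)" "(z, 0)"]
      even_bilinear_add(2)[OF l, of "(x, 0)" "(y, 0)" "(z, 0)"] by simp_all
  moreover have "fst c x (scl L a y) = scl K a (fst c x y)"
    "fst c (scl L a x) y = scl K a (fst c x y)" for a x y
  proof -
    have "brk ?T (x, 0) (scl ?T a (y, 0)) = scl ?T a (brk ?T (x, 0) (y, 0))"
      "brk ?T (scl ?T a (x, 0)) (y, 0) = scl ?T a (brk ?T (x, 0) (y, 0))"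
      using l unfolding even_bilinear_iff by blast+
    thus "fst c x (scl L a y) = scl K a (fst c x y)" "fst c (scl L a x) y = scl K a (fst c x y)"
      by simp_all
  qed
  ultimately show "even_bilinear L K (fst c)"
    using superspace_vector_space[OF L] superspace_vector_space[OF K] unfolding even_bilinear_iff by blast
qed

text \<open>In the last two terms of \<open>d2\<close> skew-symmetry moves the bracket into the
  second slot. The bracket of \<open>x\<close> and \<open>z\<close> has parity \<open>i + k\<close>,
  so the sign from \<open>j * k\<close> becomes that from \<open>i * j\<close>. The outcome is the
  \<open>K\<close>-coordinate of the Jacobi identity in the form used by
  \<open>lie_superalgebra\<close>.\<close>

lemma d2_eq:
  assumes f: "even_bilinear L M f" "super_skew L f" and br: "even_bilinear L L (brk L)"
    and x: "x \<in> grade L i" and y: "y \<in> grade L j" and z: "z \<in> grade L k"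
  shows "d2 L f (i, x) (j, y) (k, z) =
    f x (brk L y z) - (f (brk L x y) z + koszul (i * j) (f y (brk L x z)))"
proof -
  have "brk L x z \<in> grade L (i + k)" "brk L y z \<in> grade L (j + k)"
    using br x y z unfolding even_bilinear_iff by blast+
  hence "f (brk L x z) y = - koszul ((i + k) * j) (f y (brk L x z))"
    "f (brk L y z) x = - koszul ((j + k) * i) (f x (brk L y z))"
    using f(2) x y unfolding super_skew_def by blast+
  thus ?thesis
    by (cases i; cases j; cases k) (simp_all add: d2_def koszul_def)
qed

lemma lie_superalgebra_twisted_prod:
  assumes L: "lie_superalgebra L" and K: "superspace K"
  shows "lie_superalgebra (twisted_prod L K c) \<longleftrightarrow> fst c \<in> cochains2 L K \<and>
    (\<forall>i j k. \<forall>x\<in>grade L i. \<forall>y\<in>grade L j. \<forall>z\<in>grade L k. d2 L (fst c) (i, x) (j, y) (k, z) = 0)"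
    (is "_ \<longleftrightarrow> _ \<and> ?Z")
proof -
  let ?T = "twisted_prod L K c"
  have sL: "superspace L" and br: "even_bilinear L L (brk L)" and sk: "super_skew L (brk L)"
    and jac: "\<And>i j k x y z. x \<in> grade L i \<Longrightarrow> y \<in> grade L j \<Longrightarrow> z \<in> grade L k \<Longrightarrow>
       brk L x (brk L y z) = brk L (brk L x y) z + koszul (i * j) (brk L y (brk L x z))"
    using L unfolding lie_superalgebra_def by blast+
  have "super_skew ?T (brk ?T) \<longleftrightarrow> super_skew L (fst c)"
  proof
    assume T: "super_skew ?T (brk ?T)"
    show "super_skew L (fst c)"
      unfolding super_skew_def
    proof (intro allI ballI)
      fix i j x y assume "x \<in> grade L i" "y \<in> grade L j"
      hence "(x, 0) \<in> grade ?T i" "(y, 0) \<in> grade ?T j" using superspace_zero[OF K] by simp_all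
      hence "brk ?T (x, 0) (y, 0) = - koszul (i * j) (brk ?T (y, 0) (x, 0))"
        using T unfolding super_skew_def by blast
      thus "fst c x y = - koszul (i * j) (fst c y x)" by (simp add: koszul_pair)
    qed
  next
    assume a: "super_skew L (fst c)"
    show "super_skew ?T (brk ?T)"
      unfolding super_skew_def
    proof (intro allI ballI)
      fix i j u v assume "u \<in> grade ?T i" "v \<in> grade ?T j"
      hence "fst u \<in> grade L i" "fst v \<in> grade L j" by auto
      hence "fst c (fst u) (fst v) = - koszul (i * j) (fst c (fst v) (fst u))"
        "brk L (fst u) (fst v) = - koszul (i * j) (brk L (fst v) (fst u))"
        using a sk unfolding super_skew_def by blast+
      thus "brk ?T u v = - koszul (i * j) (brk ?T v u)" by (simp add: koszul_pair)
    qed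
  qed
  hence co: "even_bilinear ?T ?T (brk ?T) \<and> super_skew ?T (brk ?T) \<longleftrightarrow> fst c \<in> cochains2 L K"
    using even_bilinear_twisted_prod[OF sL K br] unfolding cochains2_def by blast
  \<comment> \<open>The Jacobi identity is compared with \<open>?Z\<close> only for cochains, since
    \<open>d2_eq\<close> already uses bilinearity and skew-symmetry of \<open>fst c\<close>.\<close>
  have "(\<forall>i j k. \<forall>u\<in>grade ?T i. \<forall>v\<in>grade ?T j. \<forall>w\<in>grade ?T k.
      brk ?T u (brk ?T v w) = brk ?T (brk ?T u v) w + koszul (i * j) (brk ?T v (brk ?T u w))) \<longleftrightarrow> ?Z"
    (is "?J \<longleftrightarrow> _") if "fst c \<in> cochains2 L K"
  proof -
    have d2: "d2 L (fst c) (i, x) (j, y) (k, z) = 0 \<longleftrightarrow>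
        fst c x (brk L y z) = fst c (brk L x y) z + koszul (i * j) (fst c y (brk L x z))"
      if "x \<in> grade L i" "y \<in> grade L j" "z \<in> grade L k" for i j k x y z
      using \<open>fst c \<in> _\<close> d2_eq[OF _ _ br that, of K "fst c"] unfolding cochains2_def by simp
    show ?thesis
    proof
      assume J: ?J
      show ?Z
      proof (intro allI ballI)
        fix i j k x y z assume xyz: "x \<in> grade L i" "y \<in> grade L j" "z \<in> grade L k"
        hence "(x, 0) \<in> grade ?T i" "(y, 0) \<in> grade ?T j" "(z, 0) \<in> grade ?T k"
          using superspace_zero[OF K] by simp_all
        hence "brk ?T (x, 0) (brk ?T (y, 0) (z, 0)) = brk ?T (brk ?T (x, 0) (y, 0)) (z, 0) +
            koszul (i * j) (brk ?T (y, 0) (brk ?T (x, 0) (z, 0)))"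
          using J by blast
        thus "d2 L (fst c) (i, x) (j, y) (k, z) = 0" by (simp add: d2[OF xyz] koszul_pair)
      qed
    next
      assume Z: ?Z
      show ?J
      proof (intro allI ballI)
        fix i j k u v w assume "u \<in> grade ?T i" "v \<in> grade ?T j" "w \<in> grade ?T k"
        hence uvw: "fst u \<in> grade L i" "fst v \<in> grade L j" "fst w \<in> grade L k" by auto
        have "d2 L (fst c) (i, fst u) (j, fst v) (k, fst w) = 0" using Z uvw by blast
        thus "brk ?T u (brk ?T v w) =
            brk ?T (brk ?T u v) w + koszul (i * j) (brk ?T v (brk ?T u w))"
          unfolding d2[OF uvw] using jac[OF uvw] by (simp add: koszul_pair)
      qed
    qed
  qed
  thus ?thesis
    using co superspace_twisted_prod[OF sL K, of c] unfolding lie_superalgebra_def by blast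
qed

text \<open>Each bracket forgets the \<open>K\<close>-coordinates produced before it, so
  \<open>c\<close> enters only through the outermost one. Over the words in Jacobson's sum, this
  second coordinate gives exactly the summands of the \<open>*\<close>-property.\<close>

lemma lbrk_twisted_prod:
  assumes "length us \<ge> 2"
  shows "lbrk (twisted_prod L K c) us = (lbrk L (map fst us),
    fst c (lbrk L (butlast (map fst us))) (last (map fst us)))"
proof -
  have ne: "us \<noteq> []" "butlast us \<noteq> []" using assms by (cases us; auto)+
  have "fst (lbrk (twisted_prod L K c) vs) = lbrk L (map fst vs)" if "vs \<noteq> []" for vs
    by (rule lbrk_map[OF _ that]) simp
  from this[OF ne(2)] show ?thesis
    using ne assms
    by (simp add: lbrk_snoc[of us] lbrk_snoc[of "map fst us"] last_map map_butlast)
qed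

lemma jsum_twisted_prod:
  fixes L :: "('f::field, 'l::ab_group_add) superalg" and K :: "('f, 'k::ab_group_add) superalg"
  assumes "CHAR('f) \<ge> 2"
  shows "jsum (scl (twisted_prod L K c)) (lbrk (twisted_prod L K c)) u v =
    (jsum (scl L) (lbrk L) (fst u) (fst v),
     jsum (scl K) (\<lambda>xs. fst c (lbrk L (butlast xs)) (last xs)) (fst u) (fst v))"
proof -
  have "lbrk (twisted_prod L K c) (map (\<lambda>b. if b then u else v) bs) =
     (lbrk L (map (\<lambda>b. if b then fst u else fst v) bs),
      fst c (lbrk L (butlast (map (\<lambda>b. if b then fst u else fst v) bs)))
        (last (map (\<lambda>b. if b then fst u else fst v) bs)))" if "length bs = CHAR('f)" for bs
  proof -
    have "map fst (map (\<lambda>b. if b then u else v) bs) = map (\<lambda>b. if b then fst u else fst v) bs"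
      by simp
    thus ?thesis
      using assms that lbrk_twisted_prod[of "map (\<lambda>b. if b then u else v) bs" L K c]
      by (simp only: length_map)
  qed
  thus ?thesis unfolding jsum_def by (intro prod_eqI) (simp_all add: fst_sum snd_sum)
qed

text \<open>Again only the outermost bracket contributes to the \<open>K\<close>-coordinate. The
  exponent \<open>Suc n\<close> will be \<open>p\<close>, which leaves the power
  \<open>p - 1\<close> occurring in \<open>ind2\<close>.\<close>

lemma funpow_brk_twisted_prod:
  "(brk (twisted_prod L K c) u ^^ Suc n) v =
    ((brk L (fst u) ^^ Suc n) (fst v), fst c (fst u) ((brk L (fst u) ^^ n) (fst v)))"
  by (induction n) simp_all

text \<open>Bracketing with the even element \<open>y\<close> on the right is minus bracketing with
  it on the left, so \<open>n\<close> steps contribute the sign of \<open>n\<close>.\<close>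

lemma lbrk_replicate:
  assumes L: "superspace L" and br: "even_bilinear L L (brk L)" "super_skew L (brk L)"
    and y: "y \<in> grade L 0"
  shows "lbrk L (x # replicate n y) = (if even n then (brk L y ^^ n) x else - (brk L y ^^ n) x)"
proof (induction n)
  case 0
  show ?case by (simp add: lbrk_def)
next
  case (Suc n)
  have "lbrk L (x # replicate (Suc n) y) = brk L (lbrk L (x # replicate n y)) y"
    by (simp only: lbrk_def replicate_append_same[symmetric] replicate_Suc list.sel foldl_append foldl.simps)
  also have "\<dots> = - brk L y (lbrk L (x # replicate n y))"
    using super_skew_even[OF L br y, of "lbrk L (x # replicate n y)"] by simp
  finally show ?case by (simp add: Suc.IH even_bilinear_minus[OF br(1)] del: replicate_Suc)
qed

text \<open>The sign $(-1)^{p-1}$ between the two iterated brackets is \<open>1\<close>, as \<open>p\<close> is odd.\<close>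

lemma ind2_eq:
  fixes L :: "('f::field, 'l::ab_group_add) superalg"
  assumes L: "restricted_lie_superalgebra L" and al: "even_bilinear L M \<alpha>" "super_skew L \<alpha>"
    and p: "odd CHAR('f)" and y: "y \<in> grade L 0"
  shows "ind2 L (\<alpha>, \<beta>) x y = \<alpha> y ((brk L y ^^ (CHAR('f) - 1)) x) - \<alpha> (pmap L y) x"
proof -
  note sL = restricted_lie_superspace[OF L]
  have "lbrk L (x # replicate (CHAR('f) - 1) y) = (brk L y ^^ (CHAR('f) - 1)) x"
    using lbrk_replicate[OF sL restricted_lie_bilinear[OF L] restricted_lie_skew[OF L] y] p by simp
  thus ?thesis
    using super_skew_even[OF sL al y, of "(brk L y ^^ (CHAR('f) - 1)) x"]
      super_skew_even[OF sL al restricted_lie_pmap[OF L y], of x]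
    by (simp add: ind2_def)
qed

text \<open>The axioms see a \<open>p\<close>-map only on even elements, whereas a restricted
  cochain is extended by zero; the assumption on \<open>\<beta>\<close> fixes it off the even part.
  The Lie axioms give \<open>d2 = 0\<close>, the semilinearity and additivity of the
  \<open>p\<close>-map give the \<open>*\<close>-property, and the adjoint axioms give
  \<open>ind2 = 0\<close>.\<close>

lemma restricted_lie_superalgebra_twisted_prod:
  fixes L :: "('f::field, 'l::ab_group_add) superalg" and K :: "('f, 'k::ab_group_add) superalg"
  assumes L: "restricted_lie_superalgebra L" and K: "superspace K" and p: "odd CHAR('f)" "CHAR('f) \<ge> 2"
    and b: "\<And>x. x \<notin> grade L 0 \<Longrightarrow> \<beta> x = 0"
  shows "restricted_lie_superalgebra (twisted_prod L K (\<alpha>, \<beta>)) \<longleftrightarrow> (\<alpha>, \<beta>) \<in> restr_cocycles2 L K"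
proof (cases "\<alpha> \<in> cochains2 L K")
  case False
  thus ?thesis
    using lie_superalgebra_twisted_prod[OF restricted_lie_lie[OF L] K, of "(\<alpha>, \<beta>)"]
    unfolding restricted_lie_superalgebra_def restr_cocycles2_def restr_cochains2_def by auto
next
  case al: True
  let ?T = "twisted_prod L K (\<alpha>, \<beta>)"
  let ?p = "CHAR('f)"
  have al': "even_bilinear L K \<alpha>" "super_skew L \<alpha>" using al unfolding cochains2_def by auto
  note sL = restricted_lie_superspace[OF L]
  note brL = restricted_lie_bilinear[OF L]
  have scL: "pmap L (scl L r x) = scl L (r ^ ?p) (pmap L x)"
    and adL: "y \<in> grade L 0 \<Longrightarrow> pmap L (x + y) = pmap L x + pmap L y + jsum (scl L) (lbrk L) x y"
    and pL: "y \<in> grade L 0 \<or> y \<in> grade L 1 \<Longrightarrow> brk L (pmap L x) y = (brk L x ^^ ?p) y"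
    if "x \<in> grade L 0" for r x y
    using L that unfolding restricted_lie_superalgebra_def by blast+
  \<comment> \<open>In this and the next two comparisons the \<open>L\<close>-coordinate holds by
    the axioms of \<open>L\<close>; pairs \<open>(x, 0)\<close> isolate the condition on
    \<open>\<beta>\<close>.\<close>
  have val: "(\<forall>u\<in>grade ?T 0. pmap ?T u \<in> grade ?T 0) \<longleftrightarrow> (\<forall>x\<in>grade L 0. \<beta> x \<in> grade K 0)"
    using superspace_zero[OF K] restricted_lie_pmap[OF L] by fastforce
  have sca: "(\<forall>r. \<forall>u\<in>grade ?T 0. pmap ?T (scl ?T r u) = scl ?T (r ^ ?p) (pmap ?T u)) \<longleftrightarrow>
      (\<forall>r. \<forall>x\<in>grade L 0. \<beta> (scl L r x) = scl K (r ^ ?p) (\<beta> x))"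
    using superspace_zero[OF K] scL by fastforce
  have add: "(\<forall>u\<in>grade ?T 0. \<forall>v\<in>grade ?T 0.
       pmap ?T (u + v) = pmap ?T u + pmap ?T v + jsum (scl ?T) (lbrk ?T) u v) \<longleftrightarrow>
      (\<forall>x\<in>grade L 0. \<forall>y\<in>grade L 0. \<beta> (x + y) = \<beta> x + \<beta> y +
         jsum (scl K) (\<lambda>xs. \<alpha> (lbrk L (butlast xs)) (last xs)) x y)"
    unfolding jsum_twisted_prod[OF p(2)] using superspace_zero[OF K] adL by fastforce
  have pw: "(brk ?T u ^^ ?p) v =
      ((brk L (fst u) ^^ ?p) (fst v), \<alpha> (fst u) ((brk L (fst u) ^^ (?p - 1)) (fst v)))" for u v
    using funpow_brk_twisted_prod[of "?p - 1" L K "(\<alpha>, \<beta>)" u v] p(2) by simp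
  \<comment> \<open>\<open>?G x y\<close> is the \<open>K\<close>-coordinate of the axiom that the
    \<open>p\<close>-map of \<open>x\<close> acts on \<open>y\<close> as the \<open>p\<close>-th
    power of \<open>ad x\<close>. By \<open>ind2_eq\<close> it says that \<open>ind2\<close>
    vanishes at \<open>y x\<close>, with the arguments exchanged.\<close>
  let ?G = "\<lambda>x y. \<alpha> (pmap L x) y = \<alpha> x ((brk L x ^^ (?p - 1)) y)"
  have mo: "(\<forall>u\<in>grade ?T 0. \<forall>v\<in>grade ?T i. brk ?T (pmap ?T u) v = (brk ?T u ^^ ?p) v) \<longleftrightarrow>
      (\<forall>x\<in>grade L 0. \<forall>y\<in>grade L i. ?G x y)" for i
    unfolding pw using superspace_zero[OF K] pL by (cases i) fastforce+
  have fpa: "(brk L x ^^ n) (y + z) = (brk L x ^^ n) y + (brk L x ^^ n) z" for x y z n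
    by (induction n) (simp_all add: even_bilinear_add[OF brL])
  \<comment> \<open>The algebra axiom gives \<open>?G\<close> for even \<open>y\<close> and the
    module axiom for odd \<open>y\<close>; additivity in \<open>y\<close> reaches the arbitrary
    first argument of \<open>ind2\<close>.\<close>
  have "?G x y" if "\<forall>y\<in>grade L 0. ?G x y" "\<forall>y\<in>grade L 1. ?G x y" for x y
  proof -
    obtain a b where "a \<in> grade L 0" "b \<in> grade L 1" "y = a + b"
      using sL by (rule superspace_decomp)
    thus ?thesis using that by (simp add: fpa even_bilinear_add[OF al'(1)])
  qed
  hence "(\<forall>x\<in>grade L 0. \<forall>y\<in>grade L 0. ?G x y) \<and> (\<forall>x\<in>grade L 0. \<forall>y\<in>grade L 1. ?G x y) \<longleftrightarrow>
      (\<forall>x. \<forall>y\<in>grade L 0. ?G y x)"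
    by blast
  also have "\<dots> \<longleftrightarrow> (\<forall>x. \<forall>y\<in>grade L 0. ind2 L (\<alpha>, \<beta>) x y = 0)"
    using ind2_eq[OF L al' p(1)] by auto
  finally have ind: "(\<forall>x\<in>grade L 0. \<forall>y\<in>grade L 0. ?G x y) \<and>
      (\<forall>x\<in>grade L 0. \<forall>y\<in>grade L 1. ?G x y) \<longleftrightarrow> (\<forall>x. \<forall>y\<in>grade L 0. ind2 L (\<alpha>, \<beta>) x y = 0)" .
  show ?thesis
    unfolding restricted_lie_superalgebra_def lie_superalgebra_twisted_prod[OF restricted_lie_lie[OF L] K]
      val sca add mo restr_cocycles2_def restr_cochains2_def star_property_def fst_conv
    using al b ind by auto
qed

section \<open>The central extension attached to a cocycle\<close>

definition twisted_ext ::
    "('f::field, 'l::ab_group_add) superalg \<Rightarrow> ('f, 'k::ab_group_add) superalg \<Rightarrow>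
     ('l \<Rightarrow> 'l \<Rightarrow> 'k) \<times> ('l \<Rightarrow> 'k) \<Rightarrow> ('f, 'k, 'l \<times> 'k, 'l) extension"
  where "twisted_ext L K c = (twisted_prod L K c, \<lambda>k. (0, k), fst)"

lemma restricted_central_extension_twisted_ext:
  fixes L :: "('f::field, 'l::ab_group_add) superalg" and K :: "('f, 'k::ab_group_add) superalg"
  assumes L: "restricted_lie_superalgebra L" and K: "superspace K" "strongly_abelian K"
    and p: "odd CHAR('f)" "CHAR('f) \<ge> 2" and c: "c \<in> restr_cocycles2 L K"
  shows "restricted_central_extension L K (twisted_ext L K c)"
proof -
  let ?T = "twisted_prod L K c"
  note sL = restricted_lie_superspace[OF L]
  note brL = restricted_lie_bilinear[OF L]
  interpret l: vector_space "scl L" using sL by (rule superspace_vector_space)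
  interpret k: vector_space "scl K" using K(1) by (rule superspace_vector_space)
  obtain \<alpha> \<beta> where ab: "c = (\<alpha>, \<beta>)" by (cases c)
  have al: "even_bilinear L K \<alpha>" and off: "\<And>x. x \<notin> grade L 0 \<Longrightarrow> \<beta> x = 0"
    and star: "star_property L K \<alpha> \<beta>"
    using c unfolding ab restr_cocycles2_def restr_cochains2_def cochains2_def by auto
  have T: "restricted_lie_superalgebra ?T"
    using restricted_lie_superalgebra_twisted_prod[OF L K(1) p, of \<beta> \<alpha>] off c by (simp add: ab)
  have vT: "vector_space (scl ?T)"
    using restricted_lie_superspace[OF T] by (rule superspace_vector_space)
  \<comment> \<open>For the inclusion of \<open>K\<close> to respect the \<open>p\<close>-maps, both
    coordinates of the \<open>p\<close>-map must vanish at zero. This follows from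
    \<open>p\<close>-semilinearity with the scalar 0, as \<open>0 ^ p = 0\<close> for positive
    \<open>p\<close>.\<close>
  have p0: "pmap L 0 = 0"
  proof -
    have "pmap L (scl L 0 0) = scl L (0 ^ CHAR('f)) (pmap L 0)"
      using L superspace_zero[OF sL, of 0] unfolding restricted_lie_superalgebra_def by blast
    thus ?thesis using p(2) by (simp add: zero_power)
  qed
  have b0: "\<beta> 0 = 0"
  proof -
    have "\<beta> (scl L 0 0) = scl K (0 ^ CHAR('f)) (\<beta> 0)"
      using star superspace_zero[OF sL, of 0] unfolding star_property_def by blast
    thus ?thesis using p(2) by (simp add: zero_power)
  qed
  have "restricted_hom K ?T (\<lambda>k. (0, k))"
    unfolding restricted_hom_def even_linear_iff
    using K(2) vT k.vector_space_axioms
    by (simp add: ab p0 b0 strongly_abelian_def even_bilinear_zero[OF brL] even_bilinear_zero[OF al]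
        superspace_zero[OF sL] zero_prod_def)
  moreover have "restricted_hom ?T L fst"
    unfolding restricted_hom_def even_linear_iff using vT l.vector_space_axioms by auto
  moreover have "inj (\<lambda>k. (0 :: 'l, k :: 'k))" by (simp add: inj_on_def)
  moreover have "range (\<lambda>k. (0, k)) = {u :: 'l \<times> 'k. fst u = 0}" by force
  moreover have "range (\<lambda>k. (0, k)) \<subseteq> center ?T"
    by (auto simp: center_def ab even_bilinear_zero[OF brL] even_bilinear_zero[OF al] zero_prod_def)
  ultimately show ?thesis using T unfolding twisted_ext_def by (simp add: surj_def)
qed

subsection \<open>Sections and cocycles\<close>

text \<open>A linear right inverse of \<open>\<pi>\<close> need not be even. One is therefore chosen
  for each parity, with values in the corresponding part of \<open>E\<close>, and the two are
  combined through the parity projections of \<open>L\<close>.\<close>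

lemma even_linear_section:
  assumes E: "superspace E" and L: "superspace L" and \<pi>: "even_linear E L \<pi>" and surj: "surj \<pi>"
  obtains s where "even_linear L E s" "\<And>x. \<pi> (s x) = x"
proof -
  have vE: "vector_space (scl E)" and vL: "vector_space (scl L)"
    using E L by (simp_all add: superspace_vector_space)
  interpret vector_space_pair "scl E" "scl L"
    using vE vL by (simp add: vector_space_pair_def)
  have lin: "Vector_Spaces.linear (scl E) (scl L) \<pi>"
    and gr: "\<And>i x. x \<in> grade E i \<Longrightarrow> \<pi> x \<in> grade L i" and ad: "\<And>x y. \<pi> (x + y) = \<pi> x + \<pi> y"
    using \<pi> unfolding even_linear_def Vector_Spaces.linear_iff by blast+
  \<comment> \<open>Surjectivity passes to each graded part: in a preimage of a homogeneous
    \<open>x\<close>, the component of parity \<open>i\<close> already maps to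
    \<open>x\<close>.\<close>
  have onto: "grade L i \<subseteq> \<pi> ` grade E i" for i
  proof
    fix x assume x: "x \<in> grade L i"
    obtain e where "x = \<pi> e" using surj by blast
    moreover obtain a b where ab: "a \<in> grade E 0" "b \<in> grade E 1" "e = a + b"
      using E by (rule superspace_decomp)
    ultimately have xab: "\<pi> a + \<pi> b = x" using ad by simp
    show "x \<in> \<pi> ` grade E i"
    proof (cases "i = 0")
      case True
      have "\<pi> a = x \<and> \<pi> b = 0"
        by (rule superspace_decomp_unique[OF L])
          (use x True ab gr xab superspace_zero[OF L] in auto)
      thus ?thesis using ab True by blast
    next
      case False
      have "\<pi> a = 0 \<and> \<pi> b = x"
        by (rule superspace_decomp_unique[OF L])
          (use x False ab gr xab superspace_zero[OF L] in auto)
      thus ?thesis using ab False by auto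
    qed
  qed
  have "\<exists>g. range g \<subseteq> grade E i \<and> Vector_Spaces.linear (scl L) (scl E) g \<and>
      (\<forall>v\<in>\<pi> ` grade E i. \<pi> (g v) = v)" for i
    by (rule linear_exists_right_inverse_on[OF lin superspace_subspace[OF E]])
  then obtain g where g: "range (g i) \<subseteq> grade E i" "Vector_Spaces.linear (scl L) (scl E) (g i)"
      "v \<in> grade L i \<Longrightarrow> \<pi> (g i v) = v" for i v
    using onto by (metis subsetD)
  have "\<exists>a b. a \<in> grade L 0 \<and> b \<in> grade L 1 \<and> x = a + b" for x
    using L superspace_decomp by metis
  \<comment> \<open>\<open>p\<close> and \<open>q\<close> are the even and odd projections of
    \<open>L\<close>. They are obtained by choice; uniqueness of the decomposition makes them
    linear.\<close>
  then obtain p q where pq: "p x \<in> grade L 0" "q x \<in> grade L 1" "x = p x + q x" for x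
    by metis
  have pq_eq: "p x = a" "q x = b" if "a \<in> grade L 0" "b \<in> grade L 1" "x = a + b" for x a b
    using superspace_decomp_unique[OF L pq(1) that(1) pq(2) that(2), of x x] pq(3)[of x] that(3)
    by metis+
  have pq_add: "p (x + y) = p x + p y \<and> q (x + y) = q x + q y" for x y
  proof -
    have "x + y = (p x + p y) + (q x + q y)" using pq(3)[of x] pq(3)[of y] by (simp add: algebra_simps)
    thus ?thesis using pq_eq superspace_add[OF L] pq by metis
  qed
  have pq_scl: "p (scl L c x) = scl L c (p x) \<and> q (scl L c x) = scl L c (q x)" for c x
  proof -
    have "scl L c x = scl L c (p x) + scl L c (q x)"
      using pq(3)[of x] by (metis vs2.scale_right_distrib)
    thus ?thesis using pq_eq superspace_scl[OF L] pq by metis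
  qed
  have pq_gr: "x \<in> grade L 0 \<Longrightarrow> p x = x \<and> q x = 0" "x \<in> grade L 1 \<Longrightarrow> p x = 0 \<and> q x = x" for x
    using pq_eq[of x 0 x] pq_eq[of 0 x x] superspace_zero[OF L] by simp_all
  have ga: "g i (x + y) = g i x + g i y" and gs: "g i (scl L c x) = scl E c (g i x)" for i x y c
    using g(2)[of i] unfolding Vector_Spaces.linear_iff by blast+
  have g0: "g i 0 = 0" for i using ga[of i 0 0] by simp
  define s where "s x = g 0 (p x) + g 1 (q x)" for x
  have "s x \<in> grade E i" if "x \<in> grade L i" for x i
  proof (cases "i = 0")
    case True
    thus ?thesis using that pq_gr(1)[of x] g(1)[of 0] by (auto simp: s_def g0)
  next
    case False
    thus ?thesis using that pq_gr(2)[of x] g(1)[of 1] by (auto simp: s_def g0)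
  qed
  hence "even_linear L E s"
    unfolding even_linear_iff using vE vL
    by (auto simp: s_def pq_add pq_scl ga gs vs1.scale_right_distrib)
  moreover have "\<pi> (s x) = x" for x
    using pq(3)[of x] by (simp add: s_def ad g(3)[OF pq(1)] g(3)[OF pq(2)])
  ultimately show ?thesis using that by blast
qed

lemma foldl_zero: "(\<And>x. f 0 x = 0) \<Longrightarrow> foldl f 0 xs = 0"
  by (induction xs) auto

text \<open>The cocycle conditions are not computed directly. The product built from a section maps
  bijectively and homomorphically onto \<open>E\<close>, so it inherits the axioms by pullback, and
  the characterization of such products turns them into the cocycle conditions. The type of
  \<open>E\<close> is arbitrary.\<close>

lemma central_extension_equivalent_twisted_ext:
  fixes L :: "('f::field, 'l::ab_group_add) superalg" and K :: "('f, 'k::ab_group_add) superalg"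
    and X :: "('f, 'k, 'e::ab_group_add, 'l) extension"
  assumes L: "restricted_lie_superalgebra L" and K: "superspace K" "strongly_abelian K"
    and p: "odd CHAR('f)" "CHAR('f) \<ge> 2" and X: "restricted_central_extension L K X"
  obtains c where "c \<in> restr_cocycles2 L K" "equivalent_extensions X (twisted_ext L K c)"
proof -
  obtain E \<iota> \<pi> where XE: "X = (E, \<iota>, \<pi>)" by (cases X)
  have E: "restricted_lie_superalgebra E" and i: "restricted_hom K E \<iota>" and pi: "restricted_hom E L \<pi>"
    and inj: "inj \<iota>" and ex: "range \<iota> = {e. \<pi> e = 0}" and surj: "surj \<pi>"
    and cen: "range \<iota> \<subseteq> center E"
    using X unfolding XE restricted_central_extension.simps by blast+
  note sL = restricted_lie_superspace[OF L] and sE = restricted_lie_superspace[OF E]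
  note brE = restricted_lie_bilinear[OF E] and skE = restricted_lie_skew[OF E]
  note il = restricted_homD(1)[OF i] and pil = restricted_homD(1)[OF pi]
  interpret e: vector_space "scl E" using sE by (rule superspace_vector_space)
  obtain s where s: "even_linear L E s" and ps: "\<And>x. \<pi> (s x) = x"
    using even_linear_section[OF sE sL pil surj] by blast
  have sa: "s (x + y) = s x + s y" and ss: "s (scl L r x) = scl E r (s x)"
    and sg: "x \<in> grade L j \<Longrightarrow> s x \<in> grade E j" for x y r j
    using s unfolding even_linear_iff by blast+
  have ia: "\<iota> (k + m) = \<iota> k + \<iota> m" and isc: "\<iota> (scl K r k) = scl E r (\<iota> k)"
    and ig: "k \<in> grade K j \<Longrightarrow> \<iota> k \<in> grade E j" for k m r j
    using il unfolding even_linear_iff by blast+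
  have pa: "\<pi> (x + y) = \<pi> x + \<pi> y" for x y
    using pil unfolding even_linear_iff by blast
  have pi0: "\<pi> (\<iota> k) = 0" for k using ex by blast
  have iinv: "\<iota> (inv \<iota> u) = u" if "\<pi> u = 0" for u
    using that ex by (simp add: f_inv_into_f)
  \<comment> \<open>Both differences lie in the kernel of \<open>\<pi>\<close>, which is the range
    of \<open>\<iota>\<close>, so \<open>inv \<iota>\<close> reads them as elements of
    \<open>K\<close>.\<close>
  define \<alpha> where "\<alpha> x y = inv \<iota> (brk E (s x) (s y) - s (brk L x y))" for x y
  define \<beta> where "\<beta> x = (if x \<in> grade L 0 then inv \<iota> (pmap E (s x) - s (pmap L x)) else 0)" for x
  have al: "\<iota> (\<alpha> x y) = brk E (s x) (s y) - s (brk L x y)" for x y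
    unfolding \<alpha>_def
    by (rule iinv) (simp add: even_linear_diff[OF pil] restricted_homD(2)[OF pi] ps)
  have be: "\<iota> (\<beta> x) = pmap E (s x) - s (pmap L x)" if x: "x \<in> grade L 0" for x
    unfolding \<beta>_def if_P[OF x]
    by (rule iinv) (simp add: even_linear_diff[OF pil] restricted_homD(3)[OF pi] sg x ps)
  have cl: "brk E (\<iota> k) u = 0" for k u using cen unfolding center_def by blast
  \<comment> \<open>\<open>center\<close> is defined by brackets with the central element on the
    left. Skew-symmetry gives the other side, but only for homogeneous elements, so both arguments
    are split.\<close>
  have cr: "brk E u (\<iota> k) = 0" for k u
  proof -
    obtain a b where ab: "a \<in> grade K 0" "b \<in> grade K 1" "k = a + b"
      using K(1) by (rule superspace_decomp)
    obtain v w where vw: "v \<in> grade E 0" "w \<in> grade E 1" "u = v + w"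
      using sE by (rule superspace_decomp)
    have z: "brk E t (\<iota> m) = 0" if "t \<in> grade E j" "m \<in> grade K h" for t m j h
    proof -
      have "brk E t (\<iota> m) = - koszul (j * h) (brk E (\<iota> m) t)"
        using skE that ig unfolding super_skew_def by blast
      thus ?thesis by (simp add: cl koszul_def)
    qed
    show ?thesis
      unfolding ab(3) vw(3) ia even_bilinear_add[OF brE] 
      by (simp add: z[OF vw(1) ab(1)] z[OF vw(1) ab(2)] z[OF vw(2) ab(1)] z[OF vw(2) ab(2)])
  qed
  let ?T = "twisted_prod L K (\<alpha>, \<beta>)"
  define \<tau> where "\<tau> u = s (fst u) + \<iota> (snd u)" for u
  have sT: "superspace ?T" by (rule superspace_twisted_prod[OF sL K(1)])
  have tl: "even_linear ?T E \<tau>"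
    unfolding even_linear_iff
    using superspace_vector_space[OF sT] e.vector_space_axioms
    by (auto simp: \<tau>_def sa ss ia isc e.scale_right_distrib algebra_simps
        intro!: superspace_add[OF sE] sg ig)
  have tb: "\<tau> (brk ?T u v) = brk E (\<tau> u) (\<tau> v)" for u v
    by (simp add: \<tau>_def al even_bilinear_add[OF brE] cl cr)
  have tp: "\<tau> (pmap ?T u) = pmap E (\<tau> u)" if "u \<in> grade ?T 0" for u
  proof -
    have u: "fst u \<in> grade L 0" "snd u \<in> grade K 0" using that by auto
    \<comment> \<open>Every word in Jacobson's sum starts with \<open>s (fst u)\<close> followed by
      the central element \<open>\<iota> (snd u)\<close>, so its first bracket is already
      zero.\<close>
    have "jsum (scl E) (lbrk E) (s (fst u)) (\<iota> (snd u)) = 0"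
    proof (rule jsum_eq_0[OF e.vector_space_axioms])
      fix bs :: "bool list" assume bs: "length bs = CHAR('f)" "bs ! 0" "\<not> bs ! 1"
      then obtain cs where "bs = True # False # cs"
        using p(2) by (cases bs; cases "tl bs") auto
      thus "lbrk E (map (\<lambda>b. if b then s (fst u) else \<iota> (snd u)) bs) = 0"
        by (simp add: lbrk_def cr foldl_zero even_bilinear_zero[OF brE])
    qed
    moreover have "pmap E (\<iota> (snd u)) = 0"
      using restricted_homD(3)[OF i u(2)] K(2) u(2)
      by (simp add: strongly_abelian_def even_linear_zero[OF il])
    moreover have "pmap E (s (fst u) + \<iota> (snd u)) = pmap E (s (fst u)) + pmap E (\<iota> (snd u)) +
        jsum (scl E) (lbrk E) (s (fst u)) (\<iota> (snd u))"
      using E sg[OF u(1)] ig[OF u(2)] unfolding restricted_lie_superalgebra_def by blast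
    ultimately show ?thesis by (simp add: \<tau>_def be[OF u(1)])
  qed
  have th: "restricted_hom ?T E \<tau>" unfolding restricted_hom_def using tl tb tp by blast
  have pt: "\<pi> (\<tau> u) = fst u" for u by (simp add: \<tau>_def pa ps pi0)
  have tinj: "inj \<tau>"
  proof (rule injI)
    fix u v assume uv: "\<tau> u = \<tau> v"
    hence f: "fst u = fst v" using pt by metis
    hence "\<iota> (snd u) = \<iota> (snd v)" using uv by (simp add: \<tau>_def)
    thus "u = v" using f inj by (simp add: prod_eq_iff inj_eq)
  qed
  have tsurj: "surj \<tau>"
  proof (rule surjI)
    fix y
    \<comment> \<open>Subtracting the section's value leaves an element of the kernel, whose
      preimage in \<open>K\<close> is the second coordinate of the preimage of
      \<open>y\<close>.\<close>
    have "\<pi> (y - s (\<pi> y)) = 0" by (simp add: even_linear_diff[OF pil] ps)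
    thus "\<tau> (\<pi> y, inv \<iota> (y - s (\<pi> y))) = y" by (simp add: \<tau>_def iinv)
  qed
  have bij: "bij \<tau>" using tinj tsurj by (simp add: bij_def)
  have T: "restricted_lie_superalgebra ?T"
    using restricted_lie_superalgebra_pullback[OF sT E th tinj] p(2) by simp
  have c: "(\<alpha>, \<beta>) \<in> restr_cocycles2 L K"
    using restricted_lie_superalgebra_twisted_prod[OF L K(1) p, of \<beta> \<alpha>] T by (simp add: \<beta>_def)
  have t0: "\<tau> (0, k) = \<iota> k" for k by (simp add: \<tau>_def even_linear_zero[OF s])
  \<comment> \<open>The required equivalence starts at \<open>X\<close>, hence the inverse of
    \<open>\<tau>\<close>.\<close>
  have "restricted_hom E ?T (inv \<tau>)" by (rule restricted_hom_inv[OF T sE th bij])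
  moreover have "inv \<tau> \<circ> \<iota> = (\<lambda>k. (0, k))"
    by (rule ext) (simp add: t0[symmetric] tinj)
  moreover have "fst \<circ> inv \<tau> = \<pi>"
    by (rule ext) (simp add: pt[symmetric] surj_f_inv_f[OF tsurj])
  ultimately have "equivalent_extensions X (twisted_ext L K (\<alpha>, \<beta>))"
    unfolding XE twisted_ext_def by (auto intro!: exI[of _ "inv \<tau>"] bij bij_imp_bij_inv)
  thus ?thesis using that c by blast
qed

lemma equivalent_twisted_ext_iff:
  fixes L :: "('f::field, 'l::ab_group_add) superalg" and K :: "('f, 'k::ab_group_add) superalg"
  assumes L: "restricted_lie_superalgebra L" and K: "superspace K"
    and c: "c \<in> restr_cocycles2 L K" and c': "c' \<in> restr_cocycles2 L K"
  shows "equivalent_extensions (twisted_ext L K c) (twisted_ext L K c') \<longleftrightarrow>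
    c - c' \<in> restr_coboundaries2 L K"
proof -
  let ?T = "twisted_prod L K c" and ?T' = "twisted_prod L K c'"
  note sL = restricted_lie_superspace[OF L]
  note vs = superspace_vector_space[OF sL] superspace_vector_space[OF K]
    superspace_vector_space[OF superspace_twisted_prod[OF sL K]]
  interpret k: vector_space "scl K" by (rule vs(2))
  have off: "snd c x = 0" "snd c' x = 0" if "x \<notin> grade L 0" for x
    using c c' that unfolding restr_cocycles2_def restr_cochains2_def by auto
  show ?thesis
  proof
    assume "equivalent_extensions (twisted_ext L K c) (twisted_ext L K c')"
    then obtain \<sigma> where h: "restricted_hom ?T ?T' \<sigma>"
      and si: "\<sigma> \<circ> (\<lambda>k. (0, k)) = (\<lambda>k. (0, k))" and sp: "fst \<circ> \<sigma> = fst"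
      unfolding twisted_ext_def by auto
    \<comment> \<open>Compatibility with the projections and inclusions, together with additivity,
      leaves only the \<open>K\<close>-coordinate on pairs \<open>(x, 0)\<close>
      undetermined.\<close>
    define \<phi> where "\<phi> x = snd (\<sigma> (x, 0))" for x
    have add: "\<sigma> (u + v) = \<sigma> u + \<sigma> v" and sc: "\<sigma> (scl ?T r u) = scl ?T' r (\<sigma> u)" for u v r
      using restricted_homD(1)[OF h] unfolding even_linear_iff by blast+
    have fs: "fst (\<sigma> u) = fst u" for u using fun_cong[OF sp, of u] by simp
    have s0: "\<sigma> (x, 0) = (x, \<phi> x)" for x by (simp add: \<phi>_def prod_eq_iff fs)
    have s: "\<sigma> (x, k) = (x, \<phi> x + k)" for x k
      using add[of "(x, 0)" "(0, k)"] fun_cong[OF si, of k] by (simp add: s0)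
    have "\<phi> (x + y) = \<phi> x + \<phi> y" for x y using add[of "(x, 0)" "(y, 0)"] by (simp add: s)
    moreover have "\<phi> (scl L r x) = scl K r (\<phi> x)" for r x using sc[of r "(x, 0)"] by (simp add: s)
    moreover have "\<phi> x \<in> grade K j" if "x \<in> grade L j" for x j
      using restricted_homD(4)[OF h, of "(x, 0)" j] that superspace_zero[OF K] by (simp add: s)
    ultimately have "\<phi> \<in> cochains1 L K" using vs unfolding cochains1_def even_linear_iff by blast
    moreover have "fst c x y - fst c' x y = - \<phi> (brk L x y)" for x y
      using restricted_homD(2)[OF h, of "(x, 0)" "(y, 0)"] by (simp add: s algebra_simps)
    \<comment> \<open>The homomorphism property moves \<open>\<phi>\<close> of the
      \<open>p\<close>-map to the side of \<open>c\<close>; hence the same minus sign as for the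
      bracket, in agreement with \<open>restr_d1\<close>.\<close>
    moreover have "snd c x - snd c' x = - \<phi> (pmap L x)" if "x \<in> grade L 0" for x
      using restricted_homD(3)[OF h, of "(x, 0)"] that superspace_zero[OF K]
      by (simp add: s algebra_simps)
    \<comment> \<open>Equality of the second components on all of \<open>L\<close> uses that both
      vanish off the even part.\<close>
    ultimately have "c - c' = restr_d1 L \<phi>" "\<phi> \<in> cochains1 L K"
      by (auto simp: prod_eq_iff fun_eq_iff restr_d1_def d1_def ind1_def off)
    thus "c - c' \<in> restr_coboundaries2 L K" unfolding restr_coboundaries2_def by blast
  next
    assume "c - c' \<in> restr_coboundaries2 L K"
    then obtain \<phi> where ph: "even_linear L K \<phi>" and d: "c - c' = restr_d1 L \<phi>"
      unfolding restr_coboundaries2_def cochains1_def by blast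
    have "fst c - fst c' = d1 L \<phi>" "snd c - snd c' = - ind1 L \<phi>"
      using d unfolding restr_d1_def by (simp_all add: prod_eq_iff)
    hence "fst c x y - fst c' x y = - \<phi> (brk L x y)" "snd c z - snd c' z = - ind1 L \<phi> z" for x y z
      by (metis d1_def minus_apply, metis minus_apply uminus_apply)
    hence fc: "fst c' x y = \<phi> (brk L x y) + fst c x y" "snd c' z = ind1 L \<phi> z + snd c z" for x y z
      by (simp_all add: diff_eq_eq)
    have pa: "\<phi> (x + y) = \<phi> x + \<phi> y" and ps: "\<phi> (scl L r x) = scl K r (\<phi> x)"
      and pg: "x \<in> grade L j \<Longrightarrow> \<phi> x \<in> grade K j" for x y r j
      using ph unfolding even_linear_iff by blast+
    define \<sigma> where "\<sigma> u = (fst u, \<phi> (fst u) + snd u)" for u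
    have "even_linear ?T ?T' \<sigma>"
      unfolding even_linear_iff using vs
      by (auto simp: \<sigma>_def pa ps k.scale_right_distrib algebra_simps intro!: superspace_add[OF K] pg)
    hence "restricted_hom ?T ?T' \<sigma>"
      unfolding restricted_hom_def by (auto simp: \<sigma>_def fc ind1_def)
    moreover have "bij \<sigma>"
      by (rule o_bij[of "\<lambda>u. (fst u, snd u - \<phi> (fst u))"]) (auto simp: \<sigma>_def)
    moreover have "\<sigma> \<circ> (\<lambda>k. (0, k)) = (\<lambda>k. (0, k))" "fst \<circ> \<sigma> = fst"
      by (auto simp: \<sigma>_def even_linear_zero[OF ph])
    ultimately show "equivalent_extensions (twisted_ext L K c) (twisted_ext L K c')"
      unfolding twisted_ext_def by auto
  qed
qed

subsection \<open>Equivalence classes\<close>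

text \<open>Identities and compositions give reflexivity and transitivity. Symmetry rests on
  \<open>restricted_hom_inv\<close>: a bijective restricted homomorphism has a restricted
  homomorphism as inverse.\<close>

lemma equiv_extensions:
  fixes L :: "('f::field, 'l::ab_group_add) superalg" and K :: "('f, 'k::ab_group_add) superalg"
  defines "C \<equiv> {X :: ('f, 'k, 'e::ab_group_add, 'l) extension. restricted_central_extension L K X}"
  shows "equiv C {(X, Y). X \<in> C \<and> Y \<in> C \<and> equivalent_extensions X Y}"
proof -
  have refl: "equivalent_extensions X X" if "X \<in> C" for X
  proof -
    obtain E \<iota> \<pi> where "X = (E, \<iota>, \<pi>)" by (cases X)
    thus ?thesis
      using that restricted_hom_id[OF restricted_lie_superspace, of E] unfolding C_def by auto
  qed
  have sym: "equivalent_extensions Y X" if XC: "X \<in> C" "Y \<in> C" and eq: "equivalent_extensions X Y" for X Y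
  proof -
    obtain E \<iota> \<pi> E' \<iota>' \<pi>' where XY: "X = (E, \<iota>, \<pi>)" "Y = (E', \<iota>', \<pi>')" by (cases X, cases Y)
    then obtain \<sigma> where s: "restricted_hom E E' \<sigma>" "bij \<sigma>" "\<sigma> \<circ> \<iota> = \<iota>'" "\<pi>' \<circ> \<sigma> = \<pi>"
      using eq by auto
    have "restricted_hom E' E (inv \<sigma>)"
      using XC s(1,2) unfolding XY C_def
      by (auto intro: restricted_hom_inv restricted_lie_superspace)
    moreover have "inv \<sigma> \<circ> \<iota>' = \<iota>" "\<pi> \<circ> inv \<sigma> = \<pi>'"
      using s(2) unfolding s(3,4)[symmetric]
      by (auto simp: fun_eq_iff bij_is_inj bij_is_surj surj_f_inv_f)
    ultimately show ?thesis unfolding XY using s(2) by (auto intro: bij_imp_bij_inv)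
  qed
  have trans: "equivalent_extensions X Z" if eq: "equivalent_extensions X Y" "equivalent_extensions Y Z"
    for X Y Z :: "('f, 'k, 'e, 'l) extension"
  proof -
    obtain E \<iota> \<pi> E' \<iota>' \<pi>' E'' \<iota>'' \<pi>''
      where XYZ: "X = (E, \<iota>, \<pi>)" "Y = (E', \<iota>', \<pi>')" "Z = (E'', \<iota>'', \<pi>'')"
      by (cases X, cases Y, cases Z)
    then obtain \<sigma> \<rho> where s: "restricted_hom E E' \<sigma>" "bij \<sigma>" "\<sigma> \<circ> \<iota> = \<iota>'" "\<pi>' \<circ> \<sigma> = \<pi>"
      and r: "restricted_hom E' E'' \<rho>" "bij \<rho>" "\<rho> \<circ> \<iota>' = \<iota>''" "\<pi>'' \<circ> \<rho> = \<pi>'"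
      using eq by auto
    have "\<rho> \<circ> \<sigma> \<circ> \<iota> = \<iota>''" "\<pi>'' \<circ> (\<rho> \<circ> \<sigma>) = \<pi>"
      using s r by (auto simp: fun_eq_iff)
    thus ?thesis
      unfolding XYZ using restricted_hom_comp[OF s(1) r(1)] bij_comp[OF s(2) r(2)] by auto
  qed
  show ?thesis
    by (intro equivI refl_onI symI transI) (auto intro: refl sym trans)
qed

text \<open>\<open>R\<close> is the pullback of \<open>S\<close> along \<open>f\<close>, and
  \<open>f\<close> meets every \<open>S\<close>-class. Sending a class to its preimage under
  \<open>f\<close> is then a bijection, defined without choosing representatives: classes with equal
  nonempty preimages share an element and so coincide.\<close>

lemma bij_betw_quotients:
  assumes S: "equiv B S" and fB: "f ` A \<subseteq> B" and R: "R = {(a, a'). a \<in> A \<and> a' \<in> A \<and> (f a, f a') \<in> S}"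
    and ess: "\<And>b. b \<in> B \<Longrightarrow> \<exists>a\<in>A. (b, f a) \<in> S"
  shows "\<exists>\<Phi>. bij_betw \<Phi> (B // S) (A // R)"
proof -
  have fC: "S `` {f a} \<in> B // S" if "a \<in> A" for a using that fB by (auto intro: quotientI)
  have rep: "\<exists>a\<in>A. X = S `` {f a}" if "X \<in> B // S" for X
    using that ess equiv_class_eq[OF S] by (auto elim!: quotientE) (metis)
  have val: "{a' \<in> A. f a' \<in> S `` {f a}} = R `` {a}" if "a \<in> A" for a
    using that by (auto simp: R)
  have mem: "f a \<in> S `` {f a}" if "a \<in> A" for a
    using that fB equiv_class_self[OF S] by blast
  have "bij_betw (\<lambda>X. {a \<in> A. f a \<in> X}) (B // S) (A // R)"
    unfolding bij_betw_def
  proof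
    show "inj_on (\<lambda>X. {a \<in> A. f a \<in> X}) (B // S)"
    proof (rule inj_onI)
      fix X Y assume XY: "X \<in> B // S" "Y \<in> B // S" "{a \<in> A. f a \<in> X} = {a \<in> A. f a \<in> Y}"
      then obtain a where a: "a \<in> A" "X = S `` {f a}" using rep by blast
      hence "f a \<in> X" "f a \<in> Y" using mem XY(3) by blast+
      thus "X = Y" using quotient_disj[OF S XY(1,2)] by blast
    qed
    show "(\<lambda>X. {a \<in> A. f a \<in> X}) ` (B // S) = A // R"
    proof
      show "(\<lambda>X. {a \<in> A. f a \<in> X}) ` (B // S) \<subseteq> A // R"
        using rep val by (auto intro!: quotientI dest!: rep)
      show "A // R \<subseteq> (\<lambda>X. {a \<in> A. f a \<in> X}) ` (B // S)"
      proof
        fix Y assume "Y \<in> A // R"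
        then obtain a where "a \<in> A" "Y = R `` {a}" by (rule quotientE)
        thus "Y \<in> (\<lambda>X. {a \<in> A. f a \<in> X}) ` (B // S)"
          using val fC by (intro image_eqI[of _ _ "S `` {f a}"]) auto
      qed
    qed
  qed
  thus ?thesis by blast
qed

text \<open>The map is \<open>twisted_ext\<close>: it meets every class because sections exist, and
  it pulls equivalence back to the coboundary relation by
  \<open>equivalent_twisted_ext_iff\<close>.\<close>

lemma extension_classes_bij_cohomology:
  fixes L :: "('f::field, 'l::ab_group_add) superalg" and K :: "('f, 'k::ab_group_add) superalg"
  assumes L: "restricted_lie_superalgebra L" and K: "superspace K" "strongly_abelian K"
    and p: "odd CHAR('f)" "CHAR('f) \<ge> 2"
  shows "\<exists>\<Phi>. bij_betw \<Phi> (extension_classes L K :: ('f, 'k, 'l \<times> 'k, 'l) extension set set)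
    (restr_cohomology2 L K)"
  unfolding extension_classes_def restr_cohomology2_def
proof (rule bij_betw_quotients[where f = "twisted_ext L K"])
  note ext = restricted_central_extension_twisted_ext[OF L K p]
  show "equiv {X :: ('f, 'k, 'l \<times> 'k, 'l) extension. restricted_central_extension L K X}
      {(X, Y). restricted_central_extension L K X \<and> restricted_central_extension L K Y \<and>
        equivalent_extensions X Y}"
    using equiv_extensions[of L K] by simp
  show "twisted_ext L K ` restr_cocycles2 L K \<subseteq> {X. restricted_central_extension L K X}"
    using ext by blast
  show "{(c, c'). c \<in> restr_cocycles2 L K \<and> c' \<in> restr_cocycles2 L K \<and>
      c - c' \<in> restr_coboundaries2 L K} =
    {(c, c'). c \<in> restr_cocycles2 L K \<and> c' \<in> restr_cocycles2 L K \<and>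
      (twisted_ext L K c, twisted_ext L K c') \<in>
        {(X, Y). restricted_central_extension L K X \<and> restricted_central_extension L K Y \<and>
          equivalent_extensions X Y}}"
    using ext equivalent_twisted_ext_iff[OF L K(1)] by blast
  fix X :: "('f, 'k, 'l \<times> 'k, 'l) extension"
  assume "X \<in> {X. restricted_central_extension L K X}"
  hence X: "restricted_central_extension L K X" by simp
  obtain c where "c \<in> restr_cocycles2 L K" "equivalent_extensions X (twisted_ext L K c)"
    using central_extension_equivalent_twisted_ext[OF L K p X] by blast
  thus "\<exists>c\<in>restr_cocycles2 L K. (X, twisted_ext L K c) \<in>
      {(X, Y). restricted_central_extension L K X \<and> restricted_central_extension L K Y \<and>
        equivalent_extensions X Y}"
    using X ext by blast
qed

section \<open>The ground field as kernel, and the final theorem\<close>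

lemma superspace_field_superalg: "superspace (field_superalg :: ('f::field, 'f) superalg)"
proof -
  have "vector_space ((*) :: 'f \<Rightarrow> 'f \<Rightarrow> 'f)" by unfold_locales (simp_all add: algebra_simps)
  thus ?thesis unfolding superspace_iff by (auto simp: field_superalg_def)
qed

lemma strongly_abelian_field_superalg: "strongly_abelian field_superalg"
  by (simp add: strongly_abelian_def field_superalg_def)

theorem theorem3p7:
  fixes L :: "('f::alg_closed_field, 'l::ab_group_add) superalg"
    and K :: "('f, 'k::ab_group_add) superalg"
  assumes "CHAR('f) > 2"
    and "restricted_lie_superalgebra L"
    and "restricted_lie_superalgebra K" and "strongly_abelian K"
  shows
    "((\<exists>\<Phi>. bij_betw \<Phi>
         (extension_classes L K :: ('f, 'k, 'l \<times> 'k, 'l) extension set set)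
         (restr_cohomology2 L K)) \<and>
      (\<forall>X :: ('f, 'k, 'e::ab_group_add, 'l) extension. restricted_central_extension L K X \<longrightarrow>
         (\<exists>Y :: ('f, 'k, 'l \<times> 'k, 'l) extension.
            restricted_central_extension L K Y \<and> equivalent_extensions X Y))) \<and>
     ((\<exists>\<Psi>. bij_betw \<Psi>
         (restr_cohomology2 L (field_superalg :: ('f, 'f) superalg))
         (extension_classes L field_superalg :: ('f, 'f, 'l \<times> 'f, 'l) extension set set)) \<and>
      (\<forall>X :: ('f, 'f, 'e, 'l) extension. restricted_central_extension L field_superalg X \<longrightarrow>
         (\<exists>Y :: ('f, 'f, 'l \<times> 'f, 'l) extension.
            restricted_central_extension L field_superalg Y \<and> equivalent_extensions X Y)))"
proof -
  \<comment> \<open>A positive characteristic of a field is prime, and a prime above 2 is odd;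
    oddness is what fixes the sign in \<open>ind2_eq\<close>.\<close>
  have "prime CHAR('f)" using assms(1) by (intro prime_CHAR_semidom) simp
  hence p: "odd CHAR('f)" "CHAR('f) \<ge> 2" using assms(1) by (simp_all add: prime_odd_nat)
  note K = restricted_lie_superspace[OF assms(3)] assms(4)
  note F = superspace_field_superalg[where 'f = 'f] strongly_abelian_field_superalg
  show ?thesis
  proof (intro conjI allI impI)
    show "\<exists>\<Phi>. bij_betw \<Phi> (extension_classes L K :: ('f, 'k, 'l \<times> 'k, 'l) extension set set)
        (restr_cohomology2 L K)"
      by (rule extension_classes_bij_cohomology[OF assms(2) K p])
    show "\<exists>\<Psi>. bij_betw \<Psi> (restr_cohomology2 L (field_superalg :: ('f, 'f) superalg))
        (extension_classes L field_superalg :: ('f, 'f, 'l \<times> 'f, 'l) extension set set)"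
      using extension_classes_bij_cohomology[OF assms(2) F p] bij_betw_inv by blast
  next
    fix X :: "('f, 'k, 'e, 'l) extension" assume X: "restricted_central_extension L K X"
    show "\<exists>Y :: ('f, 'k, 'l \<times> 'k, 'l) extension.
        restricted_central_extension L K Y \<and> equivalent_extensions X Y"
      using central_extension_equivalent_twisted_ext[OF assms(2) K p X]
        restricted_central_extension_twisted_ext[OF assms(2) K p] by metis
  next
    fix X :: "('f, 'f, 'e, 'l) extension"
    assume X: "restricted_central_extension L (field_superalg :: ('f, 'f) superalg) X"
    show "\<exists>Y :: ('f, 'f, 'l \<times> 'f, 'l) extension.
        restricted_central_extension L field_superalg Y \<and> equivalent_extensions X Y"
      using central_extension_equivalent_twisted_ext[OF assms(2) F p X]
        restricted_central_extension_twisted_ext[OF assms(2) F p] by metis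
  qed
qed

end
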